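(* Fix an integer $b\ge2$ and $\gamma\in(0,1)$, and let $\phi:\mathbb{R}\to\mathbb{R}$ be a $\mathbb{Z}$-periodic Lipschitz function satisfying condition (H). Let $\alpha\in[0,1]$ be the constant such that $m_x$ is exact dimensional with $\dim(m_x)=\alpha$ for Lebesgue-a.e. $x\in[0,1]$. Then for any $\varepsilon>0$ there is $M_1(\varepsilon)$, for any $m\ge M_1(\varepsilon)$ there is $K_1(\varepsilon,m)$, and for any $k\ge K_1(\varepsilon,m)$ there is $N_1(\varepsilon,m,k)$ such that for every $n\ge N_1(\varepsilon,m,k)$, $$\nu^n\big(\{\mathbf{i}\in\Lambda^n:\ m_{\mathbf{i}(0)}\text{ is }(\alpha,\varepsilon,m)\text{-entropy porous from scale }1\text{ to }k\}\big)>1-\varepsilon.$$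
   Context: $\Lambda=\{0,\dots,b-1\}$, $\Sigma=\Lambda^{\mathbb{Z}_+}$, $\nu$ uniform on $\Lambda$. $S(x,\mathbf{j})=\sum_{n\ge1}\gamma^{n-1}\phi\big(\frac{x+j_1+j_2b+\cdots+j_nb^{n-1}}{b^n}\big)$ for $\mathbf{j}\in\Sigma$, $x\in[0,1]$; condition (H): for all $\mathbf{i}\neq\mathbf{j}\in\Sigma$, $x\mapsto S(x,\mathbf{j})-S(x,\mathbf{i})$ is not identically zero. $m_x$ is the image of $\nu^{\mathbb{Z}_+}$ under $\mathbf{j}\mapsto S(x,\mathbf{j})$ (the existence of $\alpha$ is known). For $\mathbf{i}\in\Lambda^n$ and $x\in[0,1]$, $\mathbf{i}(x)=\frac{x+i_1+i_2b+\cdots+i_nb^{n-1}}{b^n}$. $\mathcal{L}_n$ is the partition of $\mathbb{R}$ into intervals $[j/b^n,(j+1)/b^n)$, $j\in\mathbb{Z}$; $H(\mu,\mathcal{Q})=-\sum_{Q\in\mathcal{Q}}\mu(Q)\log_b\mu(Q)$. For $\mu$ a probability on $\mathbb{R}$, $\mu_{x,i}$ is $\mu$ restricted to the $\mathcal{L}_i$-interval containing $x$ and normalized. $\mu$ is $(h,\delta,m)$-entropy porous from scale $n_1$ to $n_2$ if $\frac{1}{n_2-n_1+1}\sum_{i=n_1}^{n_2}\mu\big(\{x:\frac1mH(\mu_{x,i},\mathcal{L}_{i+m})<h+\delta\}\big)>1-\delta$. *)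

theory Defs
  imports "HOL-Probability.Probability"
begin

text \<open>Digit sequences j in Sigma are represented 0-indexed: j 0 = j_1, j 1 = j_2, ...\<close>

definition Sfun :: "nat \<Rightarrow> real \<Rightarrow> (real \<Rightarrow> real) \<Rightarrow> real \<Rightarrow> (nat \<Rightarrow> nat) \<Rightarrow> real" where
  "Sfun b \<gamma> \<phi> x j =
     (\<Sum>n. \<gamma> ^ n * \<phi> ((x + (\<Sum>k<Suc n. real (j k) * real b ^ k)) / real b ^ Suc n))"

definition seq_measure :: "nat \<Rightarrow> (nat \<Rightarrow> nat) measure" where
  "seq_measure b = (\<Pi>\<^sub>M k\<in>(UNIV::nat set). measure_pmf (pmf_of_set {0..<b}))"

definition mx :: "nat \<Rightarrow> real \<Rightarrow> (real \<Rightarrow> real) \<Rightarrow> real \<Rightarrow> real measure" where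
  "mx b \<gamma> \<phi> x = distr (seq_measure b) borel (Sfun b \<gamma> \<phi> x)"

definition condH :: "nat \<Rightarrow> real \<Rightarrow> (real \<Rightarrow> real) \<Rightarrow> bool" where
  "condH b \<gamma> \<phi> \<longleftrightarrow>
     (\<forall>i j. (\<forall>k. i k < b) \<longrightarrow> (\<forall>k. j k < b) \<longrightarrow> i \<noteq> j \<longrightarrow>
        (\<exists>x\<in>{0..1}. Sfun b \<gamma> \<phi> x j - Sfun b \<gamma> \<phi> x i \<noteq> 0))"

definition exact_dimensional :: "real measure \<Rightarrow> real \<Rightarrow> bool" where
  "exact_dimensional \<mu> \<alpha> \<longleftrightarrow>
     (AE y in \<mu>. ((\<lambda>r. ln (measure \<mu> (ball y r)) / ln r) \<longlongrightarrow> \<alpha>) (at_right 0))"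

definition badic :: "nat \<Rightarrow> nat \<Rightarrow> int \<Rightarrow> real set" where
  "badic b n j = {real_of_int j / real b ^ n ..< (real_of_int j + 1) / real b ^ n}"

definition badic_cell :: "nat \<Rightarrow> nat \<Rightarrow> real \<Rightarrow> real set" where
  "badic_cell b n x = badic b n \<lfloor>real b ^ n * x\<rfloor>"

definition restr_norm :: "real measure \<Rightarrow> nat \<Rightarrow> nat \<Rightarrow> real \<Rightarrow> real set \<Rightarrow> real" where
  "restr_norm \<mu> b i x A = measure \<mu> (A \<inter> badic_cell b i x) / measure \<mu> (badic_cell b i x)"

definition part_entropy :: "nat \<Rightarrow> (real set \<Rightarrow> real) \<Rightarrow> nat \<Rightarrow> real" where
  "part_entropy b P n = (\<Sum>\<^sub>\<infinity>j::int. - P (badic b n j) * log (real b) (P (badic b n j)))"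

definition entropy_porous ::
  "nat \<Rightarrow> real measure \<Rightarrow> real \<Rightarrow> real \<Rightarrow> nat \<Rightarrow> nat \<Rightarrow> nat \<Rightarrow> bool" where
  "entropy_porous b \<mu> h \<delta> m n1 n2 \<longleftrightarrow>
     (1 / (real n2 - real n1 + 1)) *
       (\<Sum>i=n1..n2. measure \<mu>
          {x. (1 / real m) * part_entropy b (restr_norm \<mu> b i x) (i + m) < h + \<delta>})
     > 1 - \<delta>"

definition words :: "nat \<Rightarrow> nat \<Rightarrow> nat list set" where
  "words b n = {w. length w = n \<and> set w \<subseteq> {0..<b}}"

definition word_map :: "nat \<Rightarrow> nat list \<Rightarrow> real \<Rightarrow> real" where
  "word_map b w x = (x + (\<Sum>k<length w. real (w ! k) * real b ^ k)) / real b ^ length w"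

end

theory Submission
  imports Defs "HOL-Real_Asymp.Real_Asymp"
begin

text \<open>
  For a b-adic cell c of level i let h(c) be the entropy of the conditional measure on c with
  respect to level i + m, divided by m. Telescoping shows that the average of h over the cells
  (weighted by mass) and over the levels 1, ..., k is about H(m_x, L_k) / k, hence at most
  about \<alpha>. On the other hand m_x is an average of pieces, translated copies of m_y scaled by
  \<gamma>^p with \<gamma>^p comparable to b^-i. By the log-sum inequality and exact dimensionality of
  most m_y, the contribution of any family of cells of total mass t to the average is at least
  about t \<alpha>. Applied to the cells with h(c) < \<alpha> + \<epsilon>, this forces the cells with
  h(c) \<ge> \<alpha> + \<epsilon> to have small mass.

  Exact dimensionality is only known almost everywhere, whereas the points w(0) are b-adic
  rationals; since x \<mapsto> S(x, j) is Lipschitz uniformly in j, ball masses at w(0) are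
  controlled by those at nearby points, and averages over words become Lebesgue integrals.
\<close>

section \<open>Averages over words\<close>

lemma finite_words [simp]: "finite (words b n)"
  unfolding words_def using finite_lists_length_eq[of "{0..<b}" n] by (simp add: conj_commute)

lemma words_0 [simp]: "words b 0 = {[]}"
  by (auto simp: words_def)

lemma length_words: "w \<in> words b n \<Longrightarrow> length w = n"
  by (simp add: words_def)

lemma card_words: "card (words b n) = b ^ n"
  using card_lists_length_eq[of "{0..<b}" n] by (simp add: words_def conj_commute)

lemma sum_words_Suc: "(\<Sum>w\<in>words b (Suc n). f w) = (\<Sum>a<b. \<Sum>u\<in>words b n. f (a # u))"
proof -
  have "words b (Suc n) = (\<lambda>(a, u). a # u) ` ({..<b} \<times> words b n)"
    by (auto simp: words_def length_Suc_conv image_iff)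
  then have "(\<Sum>w\<in>words b (Suc n). f w) = (\<Sum>x\<in>{..<b} \<times> words b n. f ((\<lambda>(a, u). a # u) x))"
    by (simp add: sum.reindex inj_on_def)
  then show ?thesis by (simp add: sum.cartesian_product split_def)
qed

lemma sum_words_add: "(\<Sum>w\<in>words b (n + p). f w) = (\<Sum>w\<in>words b n. \<Sum>u\<in>words b p. f (w @ u))"
  by (induction n arbitrary: f) (simp_all add: sum_words_Suc)

lemma word_map_Nil [simp]: "word_map b [] x = x"
  by (simp add: word_map_def)

lemma word_map_Cons: "0 < b \<Longrightarrow> word_map b (a # w) x = word_map b w ((x + real a) / real b)"
  unfolding word_map_def
  by (simp add: sum.lessThan_Suc_shift sum_distrib_left mult.left_commute del: sum.lessThan_Suc)
     (simp add: field_simps sum_distrib_left)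

lemma word_map_append: "0 < b \<Longrightarrow> word_map b (w @ u) x = word_map b u (word_map b w x)"
  by (induction w arbitrary: x) (simp_all add: word_map_Cons)

lemma sum_word_map:
  assumes "0 < b"
  shows "(\<Sum>w\<in>words b n. f (word_map b w x)) = (\<Sum>j<b ^ n. f ((x + real j) / real b ^ n))"
proof (induction n arbitrary: x)
  case (Suc n)
  have "(\<Sum>w\<in>words b (Suc n). f (word_map b w x))
      = (\<Sum>j<b ^ n. \<Sum>a<b. f ((x + real (a + j * b)) / real b ^ Suc n))"
    using assms by (subst sum.swap) (simp add: sum_words_Suc word_map_Cons Suc field_simps)
  also have "\<dots> = (\<Sum>j<b ^ n. \<Sum>i=j*b..<j*b+b. f ((x + real i) / real b ^ Suc n))"
    by (simp add: sum.atLeastLessThan_shift_0[of _ "_ * b"] lessThan_atLeast0 add.commute)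
  also have "\<dots> = (\<Sum>i<b ^ n * b. f ((x + real i) / real b ^ Suc n))"
    by (rule sum.nat_group)
  finally show ?case by (simp add: mult.commute)
qed simp

definition word_avg :: "nat \<Rightarrow> nat \<Rightarrow> (nat list \<Rightarrow> real) \<Rightarrow> real" where
  "word_avg b n f = (\<Sum>w\<in>words b n. f w) / real b ^ n"

lemma word_avg_0 [simp]: "word_avg b 0 f = f []"
  by (simp add: word_avg_def)

lemma word_avg_Suc: "word_avg b (Suc n) f = (\<Sum>a<b. word_avg b n (\<lambda>u. f (a # u))) / real b"
  by (simp add: word_avg_def sum_words_Suc sum_divide_distrib mult.commute)

lemma word_avg_add_length: "word_avg b (n + p) f = word_avg b n (\<lambda>w. word_avg b p (\<lambda>u. f (w @ u)))"
  by (simp add: word_avg_def sum_words_add sum_divide_distrib power_add mult.commute)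

lemma word_avg_mono: "(\<And>w. w \<in> words b n \<Longrightarrow> f w \<le> g w) \<Longrightarrow> word_avg b n f \<le> word_avg b n g"
  unfolding word_avg_def by (intro divide_right_mono sum_mono) auto

lemma word_avg_const: "0 < b \<Longrightarrow> word_avg b n (\<lambda>_. c) = c"
  by (simp add: word_avg_def card_words)

lemma word_avg_add: "word_avg b n (\<lambda>w. f w + g w) = word_avg b n f + word_avg b n g"
  by (simp add: word_avg_def sum.distrib add_divide_distrib)

lemma word_avg_diff: "word_avg b n (\<lambda>w. f w - g w) = word_avg b n f - word_avg b n g"
  by (simp add: word_avg_def sum_subtractf diff_divide_distrib)

lemma word_avg_cmult: "word_avg b n (\<lambda>w. c * f w) = c * word_avg b n f"
  by (simp add: word_avg_def sum_distrib_left)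

lemma word_avg_sum: "word_avg b n (\<lambda>w. \<Sum>i\<in>I. f w i) = (\<Sum>i\<in>I. word_avg b n (\<lambda>w. f w i))"
  unfolding word_avg_def sum_divide_distrib by (rule sum.swap)

lemma word_avg_Markov:
  assumes "0 < b" "0 < t" "\<And>w. 0 \<le> f w"
  shows "1 - word_avg b n f / t \<le> real (card {w \<in> words b n. f w < t}) / real b ^ n"
proof -
  have "word_avg b n (\<lambda>w. 1 - f w / t) \<le> word_avg b n (\<lambda>w. if f w < t then 1 else 0)"
    using assms by (intro word_avg_mono) auto
  moreover have "word_avg b n (\<lambda>w. if f w < t then 1 else 0)
      = real (card {w \<in> words b n. f w < t}) / real b ^ n"
    by (simp add: word_avg_def sum.If_cases Int_def)
  moreover have "word_avg b n (\<lambda>w. 1 - f w / t) = 1 - word_avg b n f / t"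
    using word_avg_cmult[of b n "1 / t" f] word_avg_const[OF \<open>0 < b\<close>] by (simp add: word_avg_diff)
  ultimately show ?thesis by linarith
qed

abbreviation unif :: "real measure" where
  "unif \<equiv> uniform_measure lborel {0..<1}"

lemma prob_space_unif: "prob_space unif"
  by (rule prob_space_uniform_measure) auto

lemma measure_unif_grid:
  fixes N :: nat
  assumes "j < N"
  shows "measure unif {real j / real N ..< (real j + 1) / real N} = 1 / real N"
proof -
  have "(real j + 1) / real N \<le> 1" using assms by simp
  then have "{0..<1} \<inter> {real j / real N ..< (real j + 1) / real N}
      = {real j / real N ..< (real j + 1) / real N}"
    using assms by (auto intro: order_trans[rotated])
  then show ?thesis
    using assms by (simp add: diff_divide_distrib[symmetric] divide_right_mono)
qed

lemma sum_indicator_grid: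
  fixes f :: "real \<Rightarrow> real" and N :: nat
  assumes "0 < N" "0 \<le> z" "z < 1"
  shows "(\<Sum>j<N. f (real j / real N) * indicator {real j / real N ..< (real j + 1) / real N} z)
    = f (real (nat \<lfloor>real N * z\<rfloor>) / real N)"
proof -
  define k where "k = nat \<lfloor>real N * z\<rfloor>"
  have "z \<in> {real j / real N ..< (real j + 1) / real N} \<longleftrightarrow> k = j" for j
    using assms by (simp add: k_def field_simps nat_eq_iff floor_eq_iff)
  then have "(\<Sum>j<N. f (real j / real N) * indicator {real j / real N ..< (real j + 1) / real N} z)
      = (\<Sum>j<N. if j = k then f (real k / real N) else 0)"
    by (intro sum.cong) (auto simp: indicator_def)
  moreover have "k < N" using assms by (simp add: k_def nat_less_iff floor_less_iff)
  ultimately show ?thesis by (simp add: k_def)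
qed

lemma Riemann_sum_le_integral:
  assumes "0 < N" and [measurable]: "g \<in> borel_measurable borel" and bounded: "\<And>z. \<bar>g z\<bar> \<le> B"
    and dominated: "\<And>x z. \<bar>x - z\<bar> \<le> 1 / real N \<Longrightarrow> f x \<le> g z"
  shows "(\<Sum>j<N. f (real j / real N)) / real N \<le> (\<integral>z. g z \<partial>unif)"
proof -
  interpret prob_space unif by (rule prob_space_unif)
  define I where "I j = {real j / real N ..< (real j + 1) / real N}" for j
  define step where "step z = (\<Sum>j<N. f (real j / real N) * indicator (I j) z)" for z
  have "AE z in unif. step z \<le> g z"
  proof (intro AE_uniform_measureI AE_I2 impI)
    fix z :: real assume "z \<in> {0..<1}"
    then have "step z = f (real (nat \<lfloor>real N * z\<rfloor>) / real N)"
      unfolding step_def I_def using \<open>0 < N\<close> by (intro sum_indicator_grid) auto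
    also have "\<dots> \<le> g z"
    proof (rule dominated)
      have "\<bar>real (nat \<lfloor>real N * z\<rfloor>) - real N * z\<bar> \<le> 1"
        using \<open>z \<in> {0..<1}\<close> by (simp add: abs_le_iff) linarith
      then have "\<bar>real (nat \<lfloor>real N * z\<rfloor>) - real N * z\<bar> / real N \<le> 1 / real N"
        by (rule divide_right_mono) simp
      then show "\<bar>real (nat \<lfloor>real N * z\<rfloor>) / real N - z\<bar> \<le> 1 / real N"
        using \<open>0 < N\<close> by (simp add: field_simps)
    qed
    finally show "step z \<le> g z" .
  qed simp
  moreover have integrable: "integrable unif (\<lambda>z. f (real j / real N) * indicator (I j) z)" for j
    by (intro integrable_mult_right integrable_real_indicator)
      (auto simp: I_def less_top[symmetric] simp del: emeasure_uniform_measure)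
  then have "integrable unif step"
    unfolding step_def by (rule Bochner_Integration.integrable_sum)
  moreover have "integrable unif g"
    using bounded by (intro integrable_const_bound[where B=B]) auto
  ultimately have "(\<integral>z. step z \<partial>unif) \<le> (\<integral>z. g z \<partial>unif)"
    by (rule integral_mono_AE[rotated 2])
  moreover have "(\<integral>z. step z \<partial>unif) = (\<Sum>j<N. f (real j / real N) * (1 / real N))"
    unfolding step_def Bochner_Integration.integral_sum[OF integrable]
    by (intro sum.cong) (auto simp: I_def measure_unif_grid simp del: measure_uniform_measure)
  ultimately show ?thesis by (simp add: sum_divide_distrib)
qed

lemma word_avg_le_integral:
  assumes "0 < b" "g \<in> borel_measurable borel" "\<And>z. \<bar>g z\<bar> \<le> B"
    and "\<And>x z. \<bar>x - z\<bar> \<le> 1 / real b ^ n \<Longrightarrow> f x \<le> g z"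
  shows "word_avg b n (\<lambda>w. f (word_map b w 0)) \<le> (\<integral>z. g z \<partial>unif)"
  using Riemann_sum_le_integral[of "b ^ n" g B f] assms by (simp add: word_avg_def sum_word_map)

section \<open>b-adic cells\<close>

lemma mem_badic: "0 < b \<Longrightarrow> x \<in> badic b i c \<longleftrightarrow> \<lfloor>real b ^ i * x\<rfloor> = c"
  unfolding badic_def by (auto simp: floor_eq_iff field_simps)

lemma borel_badic [measurable, simp]: "badic b i c \<in> sets borel"
  by (simp add: badic_def)

lemma disjoint_family_badic: "0 < b \<Longrightarrow> disjoint_family_on (badic b i) X"
  by (auto simp: disjoint_family_on_def mem_badic)

definition children :: "nat \<Rightarrow> nat \<Rightarrow> int \<Rightarrow> int set" where
  "children b m c = {d. d div int b ^ m = c}"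

lemma children_disjoint: "c \<noteq> c' \<Longrightarrow> children b m c \<inter> children b m c' = {}"
  by (auto simp: children_def)

lemma finite_children [simp]:
  assumes "0 < b"
  shows "finite (children b m c)"
proof (rule finite_subset)
  show "children b m c \<subseteq> (\<lambda>r. c * int b ^ m + r) ` {0..<int b ^ m}"
  proof
    fix d assume "d \<in> children b m c"
    then have "d = c * int b ^ m + d mod int b ^ m"
      using div_mult_mod_eq[of d "int b ^ m"] by (simp add: children_def)
    then show "d \<in> (\<lambda>r. c * int b ^ m + r) ` {0..<int b ^ m}"
      using assms by (intro image_eqI[of _ _ "d mod int b ^ m"]) auto
  qed
qed simp

lemma floor_eq_floor_div:
  assumes "0 < b"
  shows "\<lfloor>real b ^ i * x\<rfloor> = \<lfloor>real b ^ (i + m) * x\<rfloor> div int b ^ m"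
proof -
  have "\<lfloor>real b ^ (i + m) * x / real_of_int (int b ^ m)\<rfloor> = \<lfloor>real b ^ (i + m) * x\<rfloor> div int b ^ m"
    by (rule floor_divide_real_eq_div) simp
  moreover have "real b ^ (i + m) * x / real_of_int (int b ^ m) = real b ^ i * x"
    using assms by (simp add: power_add)
  ultimately show ?thesis by simp
qed

lemma badic_Int_badic:
  assumes "0 < b"
  shows "badic b (i + m) d \<inter> badic b i c = (if d \<in> children b m c then badic b (i + m) d else {})"
proof -
  have "x \<in> badic b i c \<longleftrightarrow> d \<in> children b m c" if "x \<in> badic b (i + m) d" for x
    using that floor_eq_floor_div[OF assms, of i x m] by (simp add: mem_badic assms children_def)
  then show ?thesis by auto
qed

lemma badic_eq_UN_children:
  assumes "0 < b"
  shows "badic b i c = (\<Union>d\<in>children b m c. badic b (i + m) d)"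
proof -
  have "x \<in> badic b i c \<longleftrightarrow> x \<in> (\<Union>d\<in>children b m c. badic b (i + m) d)" for x
    using floor_eq_floor_div[OF assms, of i x m] by (simp add: mem_badic assms children_def)
  then show ?thesis by blast
qed

lemma badic_subset_ball:
  assumes "0 < b" "y \<in> badic b i c"
  shows "badic b i c \<subseteq> ball y (1 / real b ^ i)"
proof
  fix z assume "z \<in> badic b i c"
  then have "\<bar>real b ^ i * y - real b ^ i * z\<bar> < 1"
    using assms by (simp add: mem_badic) linarith
  then have "real b ^ i * \<bar>y - z\<bar> < 1"
    by (simp add: right_diff_distrib[symmetric] abs_mult)
  then show "z \<in> ball y (1 / real b ^ i)"
    using assms(1) by (simp add: dist_real_def field_simps)
qed

lemma ball_subset_badic_neighbours:
  assumes "0 < b" "y \<in> badic b i c"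
  shows "ball y (1 / real b ^ i) \<subseteq> (\<Union>d\<in>{c-1..c+1}. badic b i d)"
proof
  fix z assume "z \<in> ball y (1 / real b ^ i)"
  then have "real b ^ i * \<bar>y - z\<bar> < 1"
    using assms(1) by (simp add: dist_real_def field_simps)
  then have "\<bar>real b ^ i * y - real b ^ i * z\<bar> < 1"
    by (simp add: right_diff_distrib[symmetric] abs_mult)
  then have "\<lfloor>real b ^ i * z\<rfloor> \<in> {\<lfloor>real b ^ i * y\<rfloor> - 1..\<lfloor>real b ^ i * y\<rfloor> + 1}"
    unfolding atLeastAtMost_iff by linarith
  then show "z \<in> (\<Union>d\<in>{c-1..c+1}. badic b i d)"
    using assms by (simp add: mem_badic)
qed

section \<open>Entropy inequalities\<close>

lemma mult_ln_ratio_le: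
  fixes s t :: real
  assumes "0 \<le> t" "0 \<le> s" "0 < t \<Longrightarrow> 0 < s"
  shows "t * ln (s / t) \<le> s - t"
proof (cases "t = 0")
  case False
  then have "0 < t" "0 < s" using assms by auto
  then have "t * ln (s / t) \<le> t * (s / t - 1)"
    by (intro mult_left_mono ln_le_minus_one) auto
  also have "\<dots> = s - t" using \<open>0 < t\<close> by (simp add: field_simps)
  finally show ?thesis .
qed (use assms in simp)

lemma mult_ln_ratio_diff_le:
  fixes s t c :: real
  assumes "0 \<le> t" "0 \<le> s" "0 < t \<Longrightarrow> 0 < s" "0 < c"
  shows "t * ln (s / t) - t * ln c \<le> s / c - t"
proof (cases "t = 0")
  case False
  then have "0 < t" "0 < s" using assms by auto
  then have "t * ln (s / t) - t * ln c = t * ln (s / c / t)"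
    using \<open>0 < c\<close> by (simp add: ln_div ln_mult algebra_simps)
  also have "\<dots> \<le> s / c - t"
    using \<open>0 < t\<close> \<open>0 < s\<close> \<open>0 < c\<close> by (intro mult_ln_ratio_le) auto
  finally show ?thesis .
qed (use assms in simp)

lemma log_sum_inequality:
  fixes s t :: "'a \<Rightarrow> real"
  assumes "finite U" and t_nonneg: "\<And>u. u \<in> U \<Longrightarrow> 0 \<le> t u"
    and "\<And>u. u \<in> U \<Longrightarrow> 0 \<le> s u" "\<And>u. u \<in> U \<Longrightarrow> 0 < t u \<Longrightarrow> 0 < s u" and "1 < B"
  shows "(\<Sum>u\<in>U. t u * log B (s u / t u)) \<le> sum t U * log B (sum s U / sum t U)"
proof (cases "sum t U = 0")
  case True
  then have "\<forall>u\<in>U. t u = 0" using assms by (simp add: sum_nonneg_eq_0_iff)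
  then show ?thesis using True by simp
next
  case False
  define c where "c = sum s U / sum t U"
  obtain v where "v \<in> U" "0 < t v"
    using False t_nonneg by (metis order_less_le sum.neutral)
  then have "0 < sum t U" "0 < sum s U"
    using assms by (auto intro: sum_pos2)
  then have "0 < c" by (simp add: c_def)
  have "(\<Sum>u\<in>U. t u * ln (s u / t u) - t u * ln c) \<le> (\<Sum>u\<in>U. s u / c - t u)"
    using assms \<open>0 < c\<close> by (intro sum_mono mult_ln_ratio_diff_le) auto
  also have "\<dots> = sum s U / c - sum t U"
    by (simp add: sum_subtractf sum_divide_distrib)
  also have "\<dots> = 0"
    using \<open>0 < sum s U\<close> by (simp add: c_def)
  finally have "(\<Sum>u\<in>U. t u * ln (s u / t u)) \<le> sum t U * ln c"
    by (simp add: sum_subtractf sum_distrib_right)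
  then have "(\<Sum>u\<in>U. t u * ln (s u / t u)) / ln B \<le> sum t U * ln c / ln B"
    using \<open>1 < B\<close> by (intro divide_right_mono) auto
  then show ?thesis by (simp add: log_def sum_divide_distrib c_def)
qed

definition entropy_term :: "real \<Rightarrow> real \<Rightarrow> real" where
  "entropy_term B t = - t * log B t"

lemma entropy_term_0 [simp]: "entropy_term B 0 = 0"
  by (simp add: entropy_term_def)

lemma entropy_term_nonneg: "1 < B \<Longrightarrow> 0 \<le> t \<Longrightarrow> t \<le> 1 \<Longrightarrow> 0 \<le> entropy_term B t"
  by (cases "t = 0") (auto simp: entropy_term_def mult_nonneg_nonpos)

lemma entropy_term_le:
  assumes "1 < B" "0 \<le> t"
  shows "entropy_term B t \<le> 1 / ln B"
proof (cases "t = 0")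
  case False
  then have "- t * ln t \<le> 1 - t"
    using assms mult_ln_ratio_le[of t 1] by (simp add: ln_div)
  then have "- t * ln t / ln B \<le> 1 / ln B"
    using assms by (intro divide_right_mono) auto
  then show ?thesis by (simp add: entropy_term_def log_def)
qed (use assms in simp)

lemma entropy_term_ge:
  assumes "1 < B" "0 \<le> t" "t \<le> B powr - \<kappa>"
  shows "\<kappa> * t \<le> entropy_term B t"
proof (cases "t = 0")
  case False
  then have "\<kappa> \<le> - log B t"
    using assms log_le_iff[of B t "- \<kappa>"] by simp
  then have "\<kappa> * t \<le> - log B t * t"
    using assms by (intro mult_right_mono)
  then show ?thesis by (simp add: entropy_term_def mult.commute)
qed simp

lemma Gibbs_inequality:
  fixes p q :: "'a \<Rightarrow> real"
  assumes "finite X" and p_nonneg: "\<And>x. x \<in> X \<Longrightarrow> 0 \<le> p x" and q_pos: "\<And>x. x \<in> X \<Longrightarrow> 0 < q x"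
    and "sum q X \<le> sum p X" "1 < B"
  shows "(\<Sum>x\<in>X. entropy_term B (p x)) \<le> (\<Sum>x\<in>X. - p x * log B (q x))"
proof -
  have "p x * log B (q x / p x) = entropy_term B (p x) - - p x * log B (q x)" if "x \<in> X" for x
    using p_nonneg[OF that] q_pos[OF that] \<open>1 < B\<close>
    by (cases "p x = 0") (auto simp: entropy_term_def log_divide right_diff_distrib)
  then have "(\<Sum>x\<in>X. entropy_term B (p x) - - p x * log B (q x)) = (\<Sum>x\<in>X. p x * log B (q x / p x))"
    by simp
  also have "\<dots> \<le> sum p X * log B (sum q X / sum p X)"
    using assms by (intro log_sum_inequality) (auto simp: less_imp_le)
  also have "\<dots> \<le> 0"
  proof (cases "X = {}")
    case False
    then have "0 < sum q X" using \<open>finite X\<close> q_pos by (intro sum_pos)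
    then have "log B (sum q X / sum p X) \<le> 0"
      using \<open>sum q X \<le> sum p X\<close> \<open>1 < B\<close> by (subst log_le_zero_cancel_iff) auto
    then show ?thesis using p_nonneg by (intro mult_nonneg_nonpos sum_nonneg)
  qed simp
  finally show ?thesis by (simp only: sum_subtractf diff_le_0_iff_le)
qed

section \<open>Heavy and light balls\<close>

definition ball_mass_prob :: "'a::metric_space measure \<Rightarrow> real \<Rightarrow> real set \<Rightarrow> real" where
  "ball_mass_prob M r U = measure M {y. measure M (ball y r) \<in> U}"

abbreviation heavy_mass :: "'a::metric_space measure \<Rightarrow> real \<Rightarrow> real \<Rightarrow> real" where
  "heavy_mass M r t \<equiv> ball_mass_prob M r {t<..}"

abbreviation light_mass :: "'a::metric_space measure \<Rightarrow> real \<Rightarrow> real \<Rightarrow> real" where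
  "light_mass M r t \<equiv> ball_mass_prob M r {..<t}"

lemma ball_mass_prob_nonneg: "0 \<le> ball_mass_prob M r U"
  by (simp add: ball_mass_prob_def)

lemma abs_ball_mass_prob_le_1: "prob_space M \<Longrightarrow> \<bar>ball_mass_prob M r U\<bar> \<le> 1"
  by (simp add: ball_mass_prob_def prob_space.prob_le_1)

lemma borel_measurable_measure_Collect:
  assumes kernel: "L \<in> N \<rightarrow>\<^sub>M subprob_algebra K" and space: "space K = UNIV"
    and [measurable]: "Measurable.pred (N \<Otimes>\<^sub>M K) (\<lambda>p. P (fst p) (snd p))"
  shows "(\<lambda>x. measure (L x) {y. P x y}) \<in> borel_measurable N"
proof (rule measure_measurable_subprob_algebra2[OF _ kernel])
  have "{p \<in> space (N \<Otimes>\<^sub>M K). P (fst p) (snd p)} \<in> sets (N \<Otimes>\<^sub>M K)"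
    by measurable
  also have "{p \<in> space (N \<Otimes>\<^sub>M K). P (fst p) (snd p)} = (SIGMA x:space N. {y. P x y})"
    by (auto simp: space_pair_measure space)
  finally show "(SIGMA x:space N. {y. P x y}) \<in> sets (N \<Otimes>\<^sub>M K)" .
qed

context
  fixes L :: "'b \<Rightarrow> 'a::{metric_space, second_countable_topology} measure" and N :: "'b measure"
  assumes kernel [measurable]: "L \<in> N \<rightarrow>\<^sub>M subprob_algebra borel"
begin

lemma borel_measurable_measure_ball [measurable]:
  assumes [measurable]: "f \<in> K \<rightarrow>\<^sub>M N" "g \<in> borel_measurable K"
  shows "(\<lambda>x. measure (L (f x)) (ball (g x) r)) \<in> borel_measurable K"
  unfolding ball_def by (rule borel_measurable_measure_Collect[where K=borel]) measurable

lemma borel_measurable_ball_mass_prob: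
  assumes [measurable]: "U \<in> sets borel"
  shows "(\<lambda>x. ball_mass_prob (L x) r U) \<in> borel_measurable N"
  unfolding ball_mass_prob_def by (rule borel_measurable_measure_Collect[OF kernel]) measurable

end

lemma borel_measurable_prob_ball:
  fixes M :: "'a::{metric_space, second_countable_topology} measure"
  assumes "prob_space M" "sets M = sets borel"
  shows "(\<lambda>y. measure M (ball y r)) \<in> borel_measurable borel"
proof -
  have "M \<in> space (subprob_algebra borel)"
    using assms by (simp add: space_subprob_algebra prob_space_imp_subprob_space)
  then show ?thesis
    by (intro borel_measurable_measure_ball[where N=borel and f="\<lambda>y. y"]) auto
qed

context prob_space
begin

lemma borel_measurable_distr_ball:
  fixes X :: "'a \<Rightarrow> 'b::{metric_space, second_countable_topology}"
  assumes "random_variable borel X"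
  shows "(\<lambda>y. measure (distr M borel X) (ball y r)) \<in> borel_measurable borel"
  using assms by (intro borel_measurable_prob_ball prob_space_distr) auto

lemma ball_mass_prob_distr:
  fixes X :: "'a \<Rightarrow> 'b::{metric_space, second_countable_topology}"
  assumes [measurable]: "random_variable borel X" "U \<in> sets borel"
  shows "ball_mass_prob (distr M borel X) r U
    = prob {\<omega> \<in> space M. measure (distr M borel X) (ball (X \<omega>) r) \<in> U}"
proof -
  note [measurable] = borel_measurable_distr_ball[OF assms(1)]
  show ?thesis
    unfolding ball_mass_prob_def by (subst measure_distr) (auto intro!: arg_cong[where f=prob])
qed

lemma measure_ball_distr_perturb:
  fixes X Y :: "'a \<Rightarrow> 'b::{metric_space, second_countable_topology}"
  assumes [measurable]: "random_variable borel X" "random_variable borel Y"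
    and close: "\<And>\<omega>. dist (X \<omega>) (Y \<omega>) \<le> s"
  shows "measure (distr M borel X) (ball (X \<omega>) r)
    \<le> measure (distr M borel Y) (ball (Y \<omega>) (r + 2 * s))"
proof -
  have "X -` ball (X \<omega>) r \<subseteq> Y -` ball (Y \<omega>) (r + 2 * s)"
  proof
    fix \<omega>' assume "\<omega>' \<in> X -` ball (X \<omega>) r"
    then have "dist (X \<omega>) (X \<omega>') < r" by simp
    moreover have "dist (Y \<omega>) (Y \<omega>') \<le> dist (Y \<omega>) (X \<omega>) + dist (X \<omega>) (X \<omega>') + dist (X \<omega>') (Y \<omega>')"
      by metric
    ultimately show "\<omega>' \<in> Y -` ball (Y \<omega>) (r + 2 * s)"
      using close[of \<omega>] close[of \<omega>'] by (simp add: dist_commute)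
  qed
  then show ?thesis
    by (auto simp: measure_distr intro!: finite_measure_mono)
qed

lemma heavy_mass_distr_perturb:
  fixes X Y :: "'a \<Rightarrow> 'b::{metric_space, second_countable_topology}"
  assumes X [measurable]: "random_variable borel X" and Y [measurable]: "random_variable borel Y"
    and close: "\<And>\<omega>. dist (X \<omega>) (Y \<omega>) \<le> s"
  shows "heavy_mass (distr M borel X) r t \<le> heavy_mass (distr M borel Y) (r + 2 * s) t"
proof -
  note [measurable] = borel_measurable_distr_ball[OF Y]
  show ?thesis
    using measure_ball_distr_perturb[OF X Y close]
    by (simp add: ball_mass_prob_distr, intro finite_measure_mono) (auto intro: less_le_trans)
qed

lemma light_mass_distr_perturb:
  fixes X Y :: "'a \<Rightarrow> 'b::{metric_space, second_countable_topology}"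
  assumes X [measurable]: "random_variable borel X" and Y [measurable]: "random_variable borel Y"
    and close: "\<And>\<omega>. dist (X \<omega>) (Y \<omega>) \<le> s"
  shows "light_mass (distr M borel X) (r + 2 * s) t \<le> light_mass (distr M borel Y) r t"
proof -
  note [measurable] = borel_measurable_distr_ball[OF Y]
  have "dist (Y \<omega>) (X \<omega>) \<le> s" for \<omega> using close by (simp add: dist_commute)
  then show ?thesis
    using measure_ball_distr_perturb[OF Y X, of s]
    by (simp add: ball_mass_prob_distr, intro finite_measure_mono) (auto intro: le_less_trans)
qed

lemma ball_mass_prob_distr_similarity:
  fixes X Y :: "'a \<Rightarrow> 'b::{metric_space, second_countable_topology}"
  assumes [measurable]: "random_variable borel X" "random_variable borel Y" "U \<in> sets borel"
    and "0 < \<rho>" and similar: "\<And>\<omega> \<omega>'. dist (Y \<omega>) (Y \<omega>') = \<rho> * dist (X \<omega>) (X \<omega>')"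
  shows "ball_mass_prob (distr M borel Y) r U = ball_mass_prob (distr M borel X) (r / \<rho>) U"
proof -
  have "Y -` ball (Y \<omega>) r = X -` ball (X \<omega>) (r / \<rho>)" for \<omega>
    using \<open>0 < \<rho>\<close> by (auto simp: similar field_simps)
  then show ?thesis by (simp add: ball_mass_prob_distr measure_distr)
qed

lemma expectation_tendsto_0:
  fixes g :: "nat \<Rightarrow> 'a \<Rightarrow> real"
  assumes "\<And>n. random_variable borel (g n)" "\<And>n x. \<bar>g n x\<bar> \<le> B"
    and "AE x in M. (\<lambda>n. g n x) \<longlonglongrightarrow> 0"
  shows "(\<lambda>n. expectation (g n)) \<longlonglongrightarrow> 0"
proof -
  have "(\<lambda>n. expectation (g n)) \<longlonglongrightarrow> expectation (\<lambda>_. 0)"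
    using assms by (intro integral_dominated_convergence[where w="\<lambda>_. B"]) auto
  then show ?thesis by simp
qed

lemma prob_tendsto_0:
  assumes events: "\<And>n. E n \<in> events" and AE: "AE x in M. \<forall>\<^sub>F n in sequentially. x \<notin> E n"
  shows "(\<lambda>n. prob (E n)) \<longlonglongrightarrow> 0"
proof -
  have "AE x in M. (\<lambda>n. indicator (E n) x :: real) \<longlonglongrightarrow> 0"
    using AE
  proof eventually_elim
    case (elim x)
    then have "\<forall>\<^sub>F n in sequentially. indicator (E n) x = (0::real)" by eventually_elim simp
    then show ?case by (rule tendsto_eventually)
  qed
  then have "(\<lambda>n. expectation (indicator (E n)) :: real) \<longlonglongrightarrow> 0"
    using events
    by (intro expectation_tendsto_0[where B=1]) (auto simp: indicator_def)
  then show ?thesis using events by simp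
qed

end

lemma AE_measure_ball_pos:
  fixes M :: "'a::{metric_space, second_countable_topology} measure"
  assumes "finite_measure M" and sets_M: "sets M = sets borel" and "0 < r"
  shows "AE y in M. 0 < measure M (ball y r)"
proof -
  interpret finite_measure M by fact
  obtain D :: "'a set" where "countable D" and dense: "\<And>U. open U \<Longrightarrow> U \<noteq> {} \<Longrightarrow> \<exists>d\<in>D. d \<in> U"
    by (rule countable_dense_setE) blast
  have "AE y in M. y \<notin> ball d (r / 2)" if "measure M (ball d (r / 2)) = 0" for d
    using that sets_M by (intro AE_not_in null_setsI) (auto simp: emeasure_eq_measure)
  then have "AE y in M. \<forall>d\<in>D. measure M (ball d (r / 2)) = 0 \<longrightarrow> y \<notin> ball d (r / 2)"
    using \<open>countable D\<close> by (simp add: AE_ball_countable)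
  then show ?thesis
  proof eventually_elim
    case (elim y)
    obtain d where "d \<in> D" and close: "dist y d < r / 2"
      using dense[of "ball y (r / 2)"] \<open>0 < r\<close> by auto
    have "0 < measure M (ball d (r / 2))"
      using elim \<open>d \<in> D\<close> close by (auto simp: dist_commute order_less_le)
    also have "\<dots> \<le> measure M (ball y r)"
    proof (rule finite_measure_mono)
      show "ball d (r / 2) \<subseteq> ball y r"
        using close by (intro subsetI, unfold mem_ball) (metis dist_triangle_half_r dist_commute)
    qed (use sets_M in simp)
    finally show ?case .
  qed
qed

lemma log_at_geometric_scales_tendsto:
  fixes F :: "real \<Rightarrow> real"
  assumes "((\<lambda>r. ln (F r) / ln r) \<longlongrightarrow> \<alpha>) (at_right 0)" "0 < c" "1 < B"
  shows "(\<lambda>n. log B (F (c / B ^ n)) / real n) \<longlonglongrightarrow> - \<alpha>"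
proof -
  have "filterlim (\<lambda>n. c / B ^ n) (at_right 0) sequentially"
    using assms(2,3) by real_asymp
  then have "(\<lambda>n. ln (F (c / B ^ n)) / ln (c / B ^ n)) \<longlonglongrightarrow> \<alpha>"
    by (rule filterlim_compose[OF assms(1)])
  moreover have "(\<lambda>n. ln (c / B ^ n) / (real n * ln B)) \<longlonglongrightarrow> - 1"
    using assms(2,3) by real_asymp
  ultimately have "(\<lambda>n. ln (F (c / B ^ n)) / ln (c / B ^ n) * (ln (c / B ^ n) / (real n * ln B)))
      \<longlonglongrightarrow> \<alpha> * - 1"
    by (rule tendsto_mult)
  moreover have "\<forall>\<^sub>F n in sequentially. c / B ^ n < 1"
    using assms(2,3) by real_asymp
  then have "\<forall>\<^sub>F n in sequentially.
      ln (F (c / B ^ n)) / ln (c / B ^ n) * (ln (c / B ^ n) / (real n * ln B))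
      = log B (F (c / B ^ n)) / real n"
  proof eventually_elim
    case (elim n)
    then have "ln (c / B ^ n) < 0" using assms(2,3) by (simp add: ln_less_zero)
    then show ?case by (simp add: log_def)
  qed
  ultimately show ?thesis by (simp add: tendsto_cong)
qed

context real_distribution
begin

lemma borel_measurable_ball [measurable]: "(\<lambda>y. prob (ball y r)) \<in> borel_measurable borel"
  using prob_space_axioms by (rule borel_measurable_prob_ball) simp

lemma heavy_mass_mono:
  assumes "r \<le> r'"
  shows "heavy_mass M r t \<le> heavy_mass M r' t"
proof -
  have "prob (ball y r) \<le> prob (ball y r')" for y
    using assms by (intro finite_measure_mono subset_ball) auto
  then show ?thesis
    unfolding ball_mass_prob_def by (intro finite_measure_mono) (auto intro: less_le_trans)
qed

text \<open>The positivity clause is needed to return from logarithms to masses, because ln 0 = 0.\<close>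

lemma AE_log_measure_ball_tendsto:
  assumes "exact_dimensional M \<alpha>" "0 < c" "1 < B"
  shows "AE y in M. (\<forall>n. 0 < prob (ball y (c / B ^ n)))
    \<and> (\<lambda>n. log B (prob (ball y (c / B ^ n))) / real n) \<longlonglongrightarrow> - \<alpha>"
proof (rule AE_conjI)
  show "AE y in M. \<forall>n. 0 < prob (ball y (c / B ^ n))"
    using assms by (auto simp: AE_all_countable intro!: AE_measure_ball_pos finite_measure_axioms)
  show "AE y in M. (\<lambda>n. log B (prob (ball y (c / B ^ n))) / real n) \<longlonglongrightarrow> - \<alpha>"
    using assms(1) unfolding exact_dimensional_def
    by eventually_elim (rule log_at_geometric_scales_tendsto[OF _ assms(2,3)])
qed

lemma AE_eventually_measure_ball_bounds:
  assumes "exact_dimensional M \<alpha>" "0 < c" "1 < B" "\<tau> < \<alpha>" "\<alpha> < \<sigma>"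
  shows "AE y in M. \<forall>\<^sub>F n in sequentially.
    B powr - (real n * \<sigma>) < prob (ball y (c / B ^ n))
    \<and> prob (ball y (c / B ^ n)) < B powr - (real n * \<tau>)"
  using AE_log_measure_ball_tendsto[OF assms(1-3)]
proof eventually_elim
  case (elim y)
  then have pos: "\<And>n. 0 < prob (ball y (c / B ^ n))"
    and lim: "(\<lambda>n. log B (prob (ball y (c / B ^ n))) / real n) \<longlonglongrightarrow> - \<alpha>" by auto
  have "\<forall>\<^sub>F n in sequentially. - \<sigma> < log B (prob (ball y (c / B ^ n))) / real n"
    using \<open>\<alpha> < \<sigma>\<close> by (intro order_tendstoD(1)[OF lim]) simp
  moreover have "\<forall>\<^sub>F n in sequentially. log B (prob (ball y (c / B ^ n))) / real n < - \<tau>"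
    using \<open>\<tau> < \<alpha>\<close> by (intro order_tendstoD(2)[OF lim]) simp
  ultimately show ?case using eventually_gt_at_top[of 0]
  proof eventually_elim
    case (elim n)
    then have "- (real n * \<sigma>) < log B (prob (ball y (c / B ^ n)))"
      "log B (prob (ball y (c / B ^ n))) < - (real n * \<tau>)"
      by (simp_all add: field_simps)
    then show ?case
      using \<open>1 < B\<close> pos[of n] by (simp add: less_log_iff log_less_iff)
  qed
qed

lemma heavy_mass_tendsto_0:
  assumes "exact_dimensional M \<alpha>" "0 < c" "1 < B" "\<tau> < \<alpha>"
  shows "(\<lambda>n. heavy_mass M (c / B ^ n) (B powr - (real n * \<tau>))) \<longlonglongrightarrow> 0"
  unfolding ball_mass_prob_def
proof (rule prob_tendsto_0)
  show "AE y in M. \<forall>\<^sub>F n in sequentially.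
      y \<notin> {y. prob (ball y (c / B ^ n)) \<in> {B powr - (real n * \<tau>)<..}}"
    using AE_eventually_measure_ball_bounds[OF assms less_add_one]
    by eventually_elim (auto elim: eventually_mono)
qed measurable

lemma light_mass_tendsto_0:
  assumes "exact_dimensional M \<alpha>" "0 < c" "1 < B" "\<alpha> < \<sigma>"
  shows "(\<lambda>n. light_mass M (c / B ^ n) (B powr - (real n * \<sigma>))) \<longlonglongrightarrow> 0"
  unfolding ball_mass_prob_def
proof (rule prob_tendsto_0)
  show "AE y in M. \<forall>\<^sub>F n in sequentially.
      y \<notin> {y. prob (ball y (c / B ^ n)) \<in> {..<B powr - (real n * \<sigma>)}}"
    using AE_eventually_measure_ball_bounds[OF assms(1-3) _ assms(4), of "\<alpha> - 1", simplified]
    by eventually_elim (auto elim: eventually_mono)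
qed measurable

end

section \<open>Entropy along the b-adic partitions\<close>

locale badic_measure = real_distribution +
  fixes b :: nat
  assumes b_ge_2: "2 \<le> b"
begin

lemma b_pos: "0 < b" "0 < real b" "1 < real b"
  using b_ge_2 by auto

definition cell_prob :: "nat \<Rightarrow> int \<Rightarrow> real" where
  "cell_prob i c = prob (badic b i c)"

text \<open>Weighted by the mass of the cell: this is the conditional entropy on c times its probability.\<close>

definition cond_entropy :: "nat \<Rightarrow> nat \<Rightarrow> int \<Rightarrow> real" where
  "cond_entropy i m c = (\<Sum>d\<in>children b m c.
     cell_prob (i + m) d * log (real b) (cell_prob i c / cell_prob (i + m) d))"

lemma cell_prob_nonneg [simp]: "0 \<le> cell_prob i c"
  by (simp add: cell_prob_def)

lemma cell_prob_le_1 [simp]: "cell_prob i c \<le> 1"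
  by (simp add: cell_prob_def)

lemma sum_cell_prob: "finite X \<Longrightarrow> (\<Sum>c\<in>X. cell_prob i c) = prob (\<Union>c\<in>X. badic b i c)"
  unfolding cell_prob_def using b_pos
  by (intro finite_measure_finite_Union[symmetric] disjoint_family_badic) auto

lemma sum_cell_prob_le_1: "finite X \<Longrightarrow> (\<Sum>c\<in>X. cell_prob i c) \<le> 1"
  by (simp add: sum_cell_prob)

lemma sum_cell_prob_children: "(\<Sum>d\<in>children b m c. cell_prob (i + m) d) = cell_prob i c"
  using b_pos sum_cell_prob[of "children b m c" "i + m"] badic_eq_UN_children[of b i c m]
  by (simp add: cell_prob_def[of i])

lemma cell_prob_child_le: "d \<in> children b m c \<Longrightarrow> cell_prob (i + m) d \<le> cell_prob i c"
  using b_pos sum_cell_prob_children[of i m c]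
  by (metis cell_prob_nonneg finite_children member_le_sum)

lemma cond_entropy_eq_diff:
  "cond_entropy i m c = (\<Sum>d\<in>children b m c. entropy_term (real b) (cell_prob (i + m) d))
     - entropy_term (real b) (cell_prob i c)"
proof -
  have "cell_prob (i + m) d * log (real b) (cell_prob i c / cell_prob (i + m) d)
      = entropy_term (real b) (cell_prob (i + m) d)
        + cell_prob (i + m) d * log (real b) (cell_prob i c)"
    if "d \<in> children b m c" for d
  proof (cases "cell_prob (i + m) d = 0")
    case False
    then have "0 < cell_prob (i + m) d" "0 < cell_prob i c"
      using cell_prob_child_le[OF that, of i] cell_prob_nonneg[of "i + m" d] by linarith+
    then show ?thesis using b_pos by (simp add: log_divide entropy_term_def algebra_simps)
  qed simp
  then show ?thesis
    by (simp add: cond_entropy_def sum.distrib sum_distrib_right[symmetric] sum_cell_prob_children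
        entropy_term_def[of _ "cell_prob i c"])
qed

lemma part_entropy_restr_norm:
  fixes x :: real and i :: nat
  defines "c \<equiv> \<lfloor>real b ^ i * x\<rfloor>"
  shows "part_entropy b (restr_norm M b i x) (i + m) = cond_entropy i m c / cell_prob i c"
proof -
  have "restr_norm M b i x (badic b (i + m) d)
      = (if d \<in> children b m c then cell_prob (i + m) d / cell_prob i c else 0)" for d
    using b_pos by (auto simp: restr_norm_def badic_cell_def c_def badic_Int_badic cell_prob_def)
  then have "part_entropy b (restr_norm M b i x) (i + m) = (\<Sum>\<^sub>\<infinity>d\<in>children b m c.
      - (cell_prob (i + m) d / cell_prob i c) * log (real b) (cell_prob (i + m) d / cell_prob i c))"
    unfolding part_entropy_def by (intro infsum_cong_neutral) auto
  also have "\<dots> = (\<Sum>d\<in>children b m c.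
      cell_prob (i + m) d * log (real b) (cell_prob i c / cell_prob (i + m) d) / cell_prob i c)"
    using b_pos unfolding infsum_finite[OF finite_children[OF b_pos(1)]]
  proof (intro sum.cong)
    fix d assume child: "d \<in> children b m c"
    show "- (cell_prob (i + m) d / cell_prob i c)
        * log (real b) (cell_prob (i + m) d / cell_prob i c)
        = cell_prob (i + m) d * log (real b) (cell_prob i c / cell_prob (i + m) d) / cell_prob i c"
    proof (cases "cell_prob (i + m) d = 0")
      case False
      then have "0 < cell_prob (i + m) d" "0 < cell_prob i c"
        using cell_prob_child_le[OF child, of i] cell_prob_nonneg[of "i + m" d] by linarith+
      then show ?thesis using b_pos by (simp add: log_divide right_diff_distrib diff_divide_distrib)
    qed simp
  qed simp
  finally show ?thesis by (simp add: cond_entropy_def sum_divide_distrib)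
qed

lemma sum_cell_prob_le_ball_mass_prob:
  assumes "finite X" and [measurable]: "U \<in> sets borel"
    and ball: "\<And>c y. c \<in> X \<Longrightarrow> y \<in> badic b i c \<Longrightarrow> prob (ball y r) \<in> U"
  shows "(\<Sum>c\<in>X. cell_prob i c) \<le> ball_mass_prob M r U"
proof -
  have "(\<Sum>c\<in>X. cell_prob i c) = prob (\<Union>c\<in>X. badic b i c)"
    using \<open>finite X\<close> by (rule sum_cell_prob)
  also have "\<dots> \<le> ball_mass_prob M r U"
    unfolding ball_mass_prob_def using ball by (intro finite_measure_mono) (blast, measurable)
  finally show ?thesis .
qed

lemma sum_heavy_cells_le:
  assumes "finite X" and heavy: "\<And>c. c \<in> X \<Longrightarrow> t < cell_prob i c"
  shows "(\<Sum>c\<in>X. cell_prob i c) \<le> heavy_mass M (1 / real b ^ i) t"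
  using \<open>finite X\<close>
proof (rule sum_cell_prob_le_ball_mass_prob)
  fix c y assume "c \<in> X" "y \<in> badic b i c"
  then have "cell_prob i c \<le> prob (ball y (1 / real b ^ i))"
    unfolding cell_prob_def using b_pos by (intro finite_measure_mono badic_subset_ball) auto
  then show "prob (ball y (1 / real b ^ i)) \<in> {t<..}"
    using heavy[OF \<open>c \<in> X\<close>] by simp
qed simp

definition neighbour_prob :: "nat \<Rightarrow> int \<Rightarrow> real" where
  "neighbour_prob i c = (\<Sum>d\<in>{c-1..c+1}. cell_prob i d)"

lemma neighbour_prob_nonneg: "0 \<le> neighbour_prob i c"
  by (simp add: neighbour_prob_def sum_nonneg)

lemma sum_light_cells_le:
  assumes "finite X" and light: "\<And>c. c \<in> X \<Longrightarrow> neighbour_prob i c < t"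
  shows "(\<Sum>c\<in>X. cell_prob i c) \<le> light_mass M (1 / real b ^ i) t"
  using \<open>finite X\<close>
proof (rule sum_cell_prob_le_ball_mass_prob)
  fix c y assume "c \<in> X" "y \<in> badic b i c"
  then have "prob (ball y (1 / real b ^ i)) \<le> neighbour_prob i c"
    unfolding neighbour_prob_def sum_cell_prob[OF finite_atLeastAtMost_int] using b_pos
    by (intro finite_measure_mono ball_subset_badic_neighbours) auto
  then show "prob (ball y (1 / real b ^ i)) \<in> {..<t}"
    using light[OF \<open>c \<in> X\<close>] by simp
qed simp

definition heavy_children :: "real \<Rightarrow> nat \<Rightarrow> nat \<Rightarrow> int \<Rightarrow> int set" where
  "heavy_children t i m c = {d \<in> children b m c. t < cell_prob (i + m) d}"

lemma finite_heavy_children [simp]: "finite (heavy_children t i m c)"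
  using b_pos by (simp add: heavy_children_def)

lemma cond_entropy_ge:
  fixes \<kappa> :: real and i m :: nat and c :: int
  defines "H \<equiv> heavy_children (real b powr - \<kappa>) i m c"
  shows "\<kappa> * (cell_prob i c - (\<Sum>d\<in>H. cell_prob (i + m) d)) - entropy_term (real b) (cell_prob i c)
    \<le> cond_entropy i m c"
proof -
  have "H \<subseteq> children b m c" by (auto simp: H_def heavy_children_def)
  then have "cell_prob i c - (\<Sum>d\<in>H. cell_prob (i + m) d)
      = (\<Sum>d\<in>children b m c - H. cell_prob (i + m) d)"
    using b_pos by (simp add: sum_diff sum_cell_prob_children)
  then have "\<kappa> * (cell_prob i c - (\<Sum>d\<in>H. cell_prob (i + m) d))
      = (\<Sum>d\<in>children b m c - H. \<kappa> * cell_prob (i + m) d)"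
    by (simp add: sum_distrib_left)
  also have "\<dots> \<le> (\<Sum>d\<in>children b m c - H. entropy_term (real b) (cell_prob (i + m) d))"
    using b_pos by (intro sum_mono entropy_term_ge) (auto simp: H_def heavy_children_def)
  also have "\<dots> \<le> (\<Sum>d\<in>children b m c. entropy_term (real b) (cell_prob (i + m) d))"
    using b_pos by (intro sum_mono2) (auto intro!: entropy_term_nonneg)
  finally show ?thesis by (simp add: cond_entropy_eq_diff)
qed

lemma sum_heavy_children_le:
  assumes "finite X"
  shows "(\<Sum>c\<in>X. \<Sum>d\<in>heavy_children t i m c. cell_prob (i + m) d)
    \<le> heavy_mass M (1 / real b ^ (i + m)) t"
proof -
  have "(\<Sum>c\<in>X. \<Sum>d\<in>heavy_children t i m c. cell_prob (i + m) d)
      = (\<Sum>d\<in>(\<Union>c\<in>X. heavy_children t i m c). cell_prob (i + m) d)"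
    using \<open>finite X\<close>
    by (intro sum.UNION_disjoint[symmetric]) (simp_all, auto simp: heavy_children_def children_def)
  also have "\<dots> \<le> heavy_mass M (1 / real b ^ (i + m)) t"
    using \<open>finite X\<close> by (intro sum_heavy_cells_le) (simp, auto simp: heavy_children_def)
  finally show ?thesis .
qed

lemma sum_cond_entropy_ge:
  assumes "finite X" and card: "card {c \<in> X. 0 < cell_prob i c} \<le> N"
  shows "\<kappa> * (\<Sum>c\<in>X. cell_prob i c) - max 0 \<kappa> * heavy_mass M (1 / real b ^ (i + m)) (real b powr - \<kappa>)
    - real N / ln (real b) \<le> (\<Sum>c\<in>X. cond_entropy i m c)"
proof -
  define heavy
    where "heavy c = (\<Sum>d\<in>heavy_children (real b powr - \<kappa>) i m c. cell_prob (i + m) d)" for c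
  have "(\<Sum>c\<in>X. entropy_term (real b) (cell_prob i c))
      = (\<Sum>c\<in>{c \<in> X. 0 < cell_prob i c}. entropy_term (real b) (cell_prob i c))"
    using \<open>finite X\<close> by (intro sum.mono_neutral_right) (auto simp: order_less_le)
  also have "\<dots> \<le> real (card {c \<in> X. 0 < cell_prob i c}) * (1 / ln (real b))"
    using b_pos by (intro sum_bounded_above entropy_term_le) auto
  also have "\<dots> \<le> real N / ln (real b)"
    using card b_pos by (simp add: divide_right_mono)
  finally have entropy: "(\<Sum>c\<in>X. entropy_term (real b) (cell_prob i c)) \<le> real N / ln (real b)" .
  have "\<kappa> * (\<Sum>c\<in>X. heavy c) \<le> max 0 \<kappa> * (\<Sum>c\<in>X. heavy c)"
    by (intro mult_right_mono sum_nonneg) (auto simp: heavy_def intro: sum_nonneg)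
  also have "\<dots> \<le> max 0 \<kappa> * heavy_mass M (1 / real b ^ (i + m)) (real b powr - \<kappa>)"
    unfolding heavy_def by (intro mult_left_mono sum_heavy_children_le \<open>finite X\<close>) simp
  finally have "\<kappa> * (\<Sum>c\<in>X. cell_prob i c)
      - max 0 \<kappa> * heavy_mass M (1 / real b ^ (i + m)) (real b powr - \<kappa>) - real N / ln (real b)
    \<le> \<kappa> * (\<Sum>c\<in>X. cell_prob i c) - \<kappa> * (\<Sum>c\<in>X. heavy c)
      - (\<Sum>c\<in>X. entropy_term (real b) (cell_prob i c))"
    using entropy by simp
  also have "\<dots> = (\<Sum>c\<in>X. \<kappa> * (cell_prob i c - heavy c) - entropy_term (real b) (cell_prob i c))"
    by (simp add: sum_subtractf right_diff_distrib sum_distrib_left)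
  also have "\<dots> \<le> (\<Sum>c\<in>X. cond_entropy i m c)"
    unfolding heavy_def by (intro sum_mono cond_entropy_ge)
  finally show ?thesis .
qed

lemma card_charged_cells_le:
  assumes "finite X" and concentrated: "AE y in M. real b ^ i * \<bar>y - a\<bar> \<le> real A"
  shows "card {c \<in> X. 0 < cell_prob i c} \<le> 2 * A + 1"
proof -
  define v where "v = \<lfloor>real b ^ i * a\<rfloor>"
  have "{c \<in> X. 0 < cell_prob i c} \<subseteq> {v - int A..v + int A}"
  proof safe
    fix c assume "0 < cell_prob i c"
    then have "\<not> (AE y in M. y \<notin> badic b i c)"
      using prob_eq_0[of "badic b i c"] by (auto simp: cell_prob_def)
    moreover have "AE y in M. y \<notin> badic b i c"
      if "\<And>y. y \<in> badic b i c \<Longrightarrow> \<not> real b ^ i * \<bar>y - a\<bar> \<le> real A"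
      using concentrated by eventually_elim (use that in blast)
    ultimately obtain y where in_cell: "y \<in> badic b i c" and near: "real b ^ i * \<bar>y - a\<bar> \<le> real A"
      by blast
    have "\<bar>real b ^ i * y - real b ^ i * a\<bar> \<le> real A"
      using near by (simp add: right_diff_distrib[symmetric] abs_mult)
    then show "c \<in> {v - int A..v + int A}"
      using in_cell b_pos unfolding v_def atLeastAtMost_iff mem_badic[OF b_pos(1)] by linarith
  qed
  then have "card {c \<in> X. 0 < cell_prob i c} \<le> card {v - int A..v + int A}"
    by (rule card_mono[rotated]) simp
  then show ?thesis by simp
qed

end

lemma sum_shift_diff_le:
  fixes f :: "nat \<Rightarrow> real"
  assumes "\<And>i. 0 \<le> f i"
  shows "(\<Sum>i=1..k. f (i + m) - f i) \<le> (\<Sum>i=k+1..k+m. f i)"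
proof -
  have "(\<Sum>i=1..k. f (i + m)) = (\<Sum>i=1+m..k+m. f i)"
    by (rule sum.shift_bounds_cl_nat_ivl[symmetric])
  also have "\<dots> \<le> (\<Sum>i=1..k+m. f i)"
    using assms by (intro sum_mono2) auto
  also have "\<dots> = (\<Sum>i=1..k. f i) + (\<Sum>i=k+1..k+m. f i)"
    using sum.ub_add_nat[of 1 k f m] by simp
  finally show ?thesis by (simp add: sum_subtractf)
qed

locale bounded_badic_measure = badic_measure +
  fixes A :: nat
  assumes AE_abs_less: "AE y in M. \<bar>y\<bar> < real A"
begin

lemma A_pos: "0 < A"
proof (rule ccontr)
  assume "\<not> 0 < A"
  then have "AE y in M. False" using AE_abs_less by simp
  then show False by (simp add: AE_False)
qed

definition cells :: "nat \<Rightarrow> int set" where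
  "cells i = {- (int A * int b ^ i) ..< int A * int b ^ i}"

definition level_entropy :: "nat \<Rightarrow> real" where
  "level_entropy i = (\<Sum>c\<in>cells i. entropy_term (real b) (cell_prob i c))"

lemma finite_cells [simp]: "finite (cells i)"
  by (simp add: cells_def)

lemma card_cells: "real (card (cells i)) = 2 * real A * real b ^ i"
  by (simp add: cells_def)

lemma floor_in_cells:
  assumes "\<bar>y\<bar> < real A"
  shows "\<lfloor>real b ^ i * y\<rfloor> \<in> cells i"
proof -
  have "real b ^ i * (- real A) \<le> real b ^ i * y" "real b ^ i * y < real b ^ i * real A"
    using assms b_pos by (intro mult_left_mono mult_strict_left_mono; simp)+
  then show ?thesis
    by (simp add: cells_def le_floor_iff floor_less_iff mult.commute)
qed

lemma prob_Collect_floor: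
  "prob {y. P \<lfloor>real b ^ i * y\<rfloor>} = (\<Sum>c\<in>{c \<in> cells i. P c}. cell_prob i c)"
proof -
  have "{y \<in> space borel. P \<lfloor>real b ^ i * y\<rfloor>} \<in> sets borel" by measurable
  then have "prob {y. P \<lfloor>real b ^ i * y\<rfloor>} = prob (\<Union>c\<in>{c \<in> cells i. P c}. badic b i c)"
    using AE_abs_less
    by (intro finite_measure_eq_AE)
      (auto intro!: sets.finite_UN elim!: eventually_mono simp: mem_badic b_pos floor_in_cells)
  then show ?thesis by (simp add: sum_cell_prob)
qed

lemma sum_cell_prob_cells: "(\<Sum>c\<in>cells i. cell_prob i c) = 1"
  using prob_Collect_floor[of "\<lambda>_. True" i] prob_space by simp

lemma cells_eq_UN_children: "cells (i + m) = (\<Union>c\<in>cells i. children b m c)"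
proof -
  have le_div_iff: "n \<le> d div int b ^ m \<longleftrightarrow> n * int b ^ m \<le> d" for n d
  proof -
    have "(d + (- n) * int b ^ m) div int b ^ m = - n + d div int b ^ m"
      using b_pos by (intro div_mult_self1) simp
    then show ?thesis
      using pos_imp_zdiv_nonneg_iff[of "int b ^ m" "d + (- n) * int b ^ m"] b_pos by simp
  qed
  have "d \<in> cells (i + m) \<longleftrightarrow> d div int b ^ m \<in> cells i" for d
    using le_div_iff[of "int A * int b ^ i" d] le_div_iff[of "- (int A * int b ^ i)" d]
    by (simp add: cells_def power_add mult.assoc not_le[symmetric])
  then show ?thesis by (auto simp: children_def)
qed

lemma sum_cond_entropy: "(\<Sum>c\<in>cells i. cond_entropy i m c) = level_entropy (i + m) - level_entropy i"
proof -
  have "(\<Sum>c\<in>cells i. \<Sum>d\<in>children b m c. entropy_term (real b) (cell_prob (i + m) d))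
      = level_entropy (i + m)"
    unfolding level_entropy_def cells_eq_UN_children
    using b_pos by (intro sum.UNION_disjoint[symmetric]) (simp_all add: children_disjoint)
  then show ?thesis by (simp add: cond_entropy_eq_diff sum_subtractf level_entropy_def)
qed

lemma level_entropy_nonneg: "0 \<le> level_entropy i"
  unfolding level_entropy_def using b_pos by (intro sum_nonneg entropy_term_nonneg) auto

lemma sum_neighbour_prob_le: "(\<Sum>c\<in>cells i. neighbour_prob i c) \<le> 3"
proof -
  have "neighbour_prob i c = (\<Sum>k\<in>{-1..1}. cell_prob i (c + k))" for c
    unfolding neighbour_prob_def
    by (rule sum.reindex_bij_witness[where i="\<lambda>k. c + k" and j="\<lambda>d. d - c"]) auto
  then have "(\<Sum>c\<in>cells i. neighbour_prob i c) = (\<Sum>k\<in>{-1..1}. \<Sum>c\<in>cells i. cell_prob i (c + k))"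
    by (simp add: sum.swap[of _ "{-1..1}"])
  also have "\<dots> \<le> (\<Sum>k\<in>{-1..1::int}. 1)"
  proof (rule sum_mono)
    fix k
    have "(\<Sum>c\<in>cells i. cell_prob i (c + k)) = (\<Sum>d\<in>(\<lambda>c. c + k) ` cells i. cell_prob i d)"
      by (subst sum.reindex) (auto simp: inj_on_def)
    also have "\<dots> \<le> 1" by (rule sum_cell_prob_le_1) simp
    finally show "(\<Sum>c\<in>cells i. cell_prob i (c + k)) \<le> 1" .
  qed
  finally show ?thesis by simp
qed

text \<open>The reference weights for Gibbs' inequality mix, in equal parts, the masses of the enlarged
  cells (each point lies in three of them) and the uniform distribution on the cells. The first
  part is large on the cells that are not light, the second gives a bound on all cells.\<close>

definition reference_weight :: "nat \<Rightarrow> int \<Rightarrow> real" where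
  "reference_weight i c = neighbour_prob i c / 6 + 1 / (2 * real (card (cells i)))"

lemma card_cells_pos: "0 < real (card (cells i))"
  using A_pos b_pos unfolding card_cells by simp

lemma reference_weight_pos: "0 < reference_weight i c"
  using neighbour_prob_nonneg[of i c] card_cells_pos[of i]
  by (simp add: reference_weight_def add_nonneg_pos)

lemma sum_reference_weight_le: "(\<Sum>c\<in>cells i. reference_weight i c) \<le> 1"
proof -
  have "(\<Sum>c\<in>cells i. reference_weight i c) = (\<Sum>c\<in>cells i. neighbour_prob i c) / 6 + 1 / 2"
    using card_cells_pos[of i]
    by (auto simp: reference_weight_def sum.distrib sum_divide_distrib card_gt_0_iff)
  then show ?thesis using sum_neighbour_prob_le[of i] by simp
qed

definition log_cell_count :: "nat \<Rightarrow> real" where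
  "log_cell_count i = log (real b) (2 * real (card (cells i)))"

lemma log_cell_count_add: "log_cell_count (k + i) = real k + log_cell_count i"
  using A_pos b_pos unfolding log_cell_count_def card_cells
  by (simp add: log_mult log_nat_power)

lemma log_cell_count_mono: "i \<le> j \<Longrightarrow> log_cell_count i \<le> log_cell_count j"
  using log_cell_count_add[of "j - i" i] by simp

lemma log_cell_count_nonneg: "0 \<le> log_cell_count i"
proof -
  have "0 \<le> log_cell_count 0"
    using A_pos b_pos unfolding log_cell_count_def card_cells by simp
  then show ?thesis using log_cell_count_mono[of 0 i] by simp
qed

lemma neg_log_reference_weight_le:
  assumes "0 \<le> \<kappa>"
  shows "- log (real b) (reference_weight i c)
    \<le> \<kappa> + log (real b) 6 + (if neighbour_prob i c < real b powr - \<kappa> then log_cell_count i else 0)"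
proof (cases "neighbour_prob i c < real b powr - \<kappa>")
  case True
  have "1 / (2 * real (card (cells i))) \<le> reference_weight i c"
    using neighbour_prob_nonneg[of i c] by (simp add: reference_weight_def)
  then have "log (real b) (1 / (2 * real (card (cells i)))) \<le> log (real b) (reference_weight i c)"
    using reference_weight_pos[of i c] card_cells_pos[of i] b_pos by simp
  moreover have "log (real b) (1 / (2 * real (card (cells i)))) = - log_cell_count i"
    using card_cells_pos[of i] b_pos unfolding log_cell_count_def by (subst log_divide) auto
  moreover have "0 \<le> log (real b) 6" using b_pos by simp
  ultimately show ?thesis unfolding if_P[OF True] using \<open>0 \<le> \<kappa>\<close> by linarith
next
  case False
  then have "real b powr - \<kappa> / 6 \<le> reference_weight i c"
    by (simp add: reference_weight_def add_increasing2)
  then have "log (real b) (real b powr - \<kappa> / 6) \<le> log (real b) (reference_weight i c)"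
    using b_pos reference_weight_pos[of i c] by simp
  then show ?thesis using False b_pos by (simp add: log_divide)
qed

lemma level_entropy_le:
  assumes "0 \<le> \<kappa>"
  shows "level_entropy i
    \<le> \<kappa> + log (real b) 6 + light_mass M (1 / real b ^ i) (real b powr - \<kappa>) * log_cell_count i"
proof -
  define Light where "Light = {c \<in> cells i. neighbour_prob i c < real b powr - \<kappa>}"
  let ?K = "\<kappa> + log (real b) 6" and ?excess = "\<lambda>c. if c \<in> Light then log_cell_count i else 0"
  have "level_entropy i \<le> (\<Sum>c\<in>cells i. cell_prob i c * - log (real b) (reference_weight i c))"
    unfolding level_entropy_def
    using Gibbs_inequality[of "cells i" "cell_prob i" "reference_weight i" "real b"] b_pos
    by (simp add: reference_weight_pos sum_reference_weight_le sum_cell_prob_cells)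
  also have "\<dots> \<le> (\<Sum>c\<in>cells i. cell_prob i c * (?K + ?excess c))"
  proof (intro sum_mono mult_left_mono)
    show "- log (real b) (reference_weight i c) \<le> ?K + ?excess c" if "c \<in> cells i" for c
      using neg_log_reference_weight_le[OF assms, of i c] that
      by (auto simp: Light_def split: if_splits)
  qed simp
  also have "\<dots> = ?K + (\<Sum>c\<in>Light. cell_prob i c) * log_cell_count i"
  proof -
    have "(\<Sum>c\<in>cells i. cell_prob i c * ?excess c) = (\<Sum>c\<in>Light. cell_prob i c * log_cell_count i)"
      by (rule sum.mono_neutral_cong_right) (auto simp: Light_def)
    then show ?thesis
      unfolding distrib_left[of _ ?K] sum.distrib
      by (simp add: sum_distrib_right[symmetric] sum_cell_prob_cells)
  qed
  also have "\<dots> \<le> ?K + light_mass M (1 / real b ^ i) (real b powr - \<kappa>) * log_cell_count i"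
    by (intro add_left_mono mult_right_mono sum_light_cells_le log_cell_count_nonneg)
      (auto simp: Light_def)
  finally show ?thesis .
qed

definition high_entropy_mass :: "real \<Rightarrow> nat \<Rightarrow> nat \<Rightarrow> real" where
  "high_entropy_mass h m i = prob {y. h \<le> 1 / real m * part_entropy b (restr_norm M b i y) (i + m)}"

lemma high_entropy_mass_nonneg: "0 \<le> high_entropy_mass h m i"
  by (simp add: high_entropy_mass_def)

lemma entropy_porous_iff:
  assumes "n1 \<le> n2"
  shows "entropy_porous b M \<alpha> \<epsilon> m n1 n2
    \<longleftrightarrow> (\<Sum>i=n1..n2. high_entropy_mass (\<alpha> + \<epsilon>) m i) < (real n2 - real n1 + 1) * \<epsilon>"
proof -
  have "(\<lambda>y. part_entropy b (restr_norm M b i y) (i + m)) \<in> borel_measurable borel" for i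
    unfolding part_entropy_restr_norm by measurable
  note [measurable] = this
  have "prob {y. 1 / real m * part_entropy b (restr_norm M b i y) (i + m) < h}
      = 1 - high_entropy_mass h m i" for h i
    using prob_neg[of "\<lambda>y. h \<le> 1 / real m * part_entropy b (restr_norm M b i y) (i + m)"]
    by (simp add: high_entropy_mass_def not_le)
  then have "entropy_porous b M \<alpha> \<epsilon> m n1 n2 \<longleftrightarrow>
      1 - \<epsilon> < (\<Sum>i=n1..n2. 1 - high_entropy_mass (\<alpha> + \<epsilon>) m i) / (real n2 - real n1 + 1)"
    by (simp add: entropy_porous_def)
  also have "\<dots> \<longleftrightarrow> (\<Sum>i=n1..n2. high_entropy_mass (\<alpha> + \<epsilon>) m i) < (real n2 - real n1 + 1) * \<epsilon>"
  proof -
    have "0 < real n2 - real n1 + 1" using assms by simp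
    then show ?thesis
      using assms by (simp add: sum_subtractf of_nat_diff pos_less_divide_eq) (simp add: algebra_simps)
  qed
  finally show ?thesis .
qed

lemma high_entropy_mass_le_level_entropy_diff:
  assumes "0 < m" "\<tau> \<le> \<alpha>"
    and lower: "\<And>X. X \<subseteq> cells i \<Longrightarrow>
      real m * \<tau> * (\<Sum>c\<in>X. cell_prob i c) - \<delta> \<le> (\<Sum>c\<in>X. cond_entropy i m c)"
  shows "real m * \<tau> + real m * \<epsilon> * high_entropy_mass (\<alpha> + \<epsilon>) m i
    \<le> level_entropy (i + m) - level_entropy i + \<delta>"
proof -
  define High
    where "High = {c \<in> cells i. \<alpha> + \<epsilon> \<le> 1 / real m * (cond_entropy i m c / cell_prob i c)}"
  have split: "sum f (cells i) = sum f (cells i - High) + sum f High" for f :: "int \<Rightarrow> real"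
    by (rule sum.subset_diff) (auto simp: High_def)
  have high: "(\<Sum>c\<in>High. cell_prob i c) = high_entropy_mass (\<alpha> + \<epsilon>) m i"
    unfolding high_entropy_mass_def part_entropy_restr_norm High_def
    by (rule prob_Collect_floor[symmetric])
  have "real m * (\<alpha> + \<epsilon>) * cell_prob i c \<le> cond_entropy i m c" if "c \<in> High" for c
  proof (cases "cell_prob i c = 0")
    case False
    then have "0 < cell_prob i c" by (simp add: order_less_le)
    then show ?thesis using that \<open>0 < m\<close> by (simp add: High_def field_simps)
  next
    case True
    then have "cell_prob (i + m) d = 0" if "d \<in> children b m c" for d
      using cell_prob_child_le[OF that, of i] cell_prob_nonneg[of "i + m" d] by linarith
    then show ?thesis using True by (simp add: cond_entropy_def)
  qed
  then have "real m * (\<alpha> + \<epsilon>) * high_entropy_mass (\<alpha> + \<epsilon>) m i \<le> (\<Sum>c\<in>High. cond_entropy i m c)"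
    unfolding high[symmetric] sum_distrib_left by (rule sum_mono)
  moreover have "(\<Sum>c\<in>cells i - High. cell_prob i c) = 1 - high_entropy_mass (\<alpha> + \<epsilon>) m i"
    using split[of "cell_prob i"] by (simp add: high sum_cell_prob_cells)
  then have "real m * \<tau> * (1 - high_entropy_mass (\<alpha> + \<epsilon>) m i) - \<delta>
      \<le> (\<Sum>c\<in>cells i - High. cond_entropy i m c)"
    using lower[of "cells i - High"] by simp
  moreover have "real m * \<tau> * high_entropy_mass (\<alpha> + \<epsilon>) m i
      \<le> real m * \<alpha> * high_entropy_mass (\<alpha> + \<epsilon>) m i"
    using \<open>\<tau> \<le> \<alpha>\<close> by (intro mult_right_mono mult_left_mono high_entropy_mass_nonneg) auto
  ultimately show ?thesis
    using split[of "cond_entropy i m"] by (simp add: sum_cond_entropy algebra_simps)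
qed

end

section \<open>Digit sequences and the random sums\<close>

lemma affine_vimage_borel:
  fixes c d :: real
  assumes "E \<in> sets borel"
  shows "(\<lambda>t. c + d * t) -` E \<in> sets borel"
  using measurable_sets[of "\<lambda>t. c + d * t" borel borel E] assms by simp

lemma (in sequence_space) measure_S_eq_integral:
  assumes [measurable]: "E \<in> sets S"
  shows "measure S E = (\<integral>a. measure S (case_nat a -` E \<inter> space S) \<partial>M)"
proof -
  interpret S: prob_space S by (intro prob_space_PiM M.prob_space_axioms)
  interpret MS: pair_prob_space M S by unfold_locales
  have "measure S E = (\<integral>\<omega>. indicator E \<omega> \<partial>distr (M \<Otimes>\<^sub>M S) S (\<lambda>(a, \<omega>). case_nat a \<omega>))"
    unfolding PiM_iter by simp
  also have "\<dots> = (\<integral>p. indicator E (case p of (a, \<omega>) \<Rightarrow> case_nat a \<omega>) \<partial>(M \<Otimes>\<^sub>M S))"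
    by (rule integral_distr) measurable
  also have "\<dots> = (\<integral>a. \<integral>\<omega>. indicator E (case_nat a \<omega>) \<partial>S \<partial>M)"
    by (subst MS.integral_fst'[symmetric]) (auto intro!: MS.integrable_const_bound[where B=1])
  also have "\<dots> = (\<integral>a. measure S (case_nat a -` E \<inter> space S) \<partial>M)"
  proof (rule Bochner_Integration.integral_cong)
    fix a assume [measurable]: "a \<in> space M"
    have "(\<integral>\<omega>. indicator E (case_nat a \<omega>) \<partial>S)
        = (\<integral>\<omega>. indicator (case_nat a -` E \<inter> space S) \<omega> \<partial>S :: real)"
      by (intro Bochner_Integration.integral_cong) (auto simp: indicator_def)
    also have "\<dots> = measure S (case_nat a -` E \<inter> space S)"
      by simp
    finally show "(\<integral>\<omega>. indicator E (case_nat a \<omega>) \<partial>S) = measure S (case_nat a -` E \<inter> space S)" .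
  qed simp
  finally show ?thesis .
qed

lemma prob_space_seq_measure: "prob_space (seq_measure b)"
  unfolding seq_measure_def by (intro prob_space_PiM prob_space_measure_pmf)

lemma space_seq_measure [simp]: "space (seq_measure b) = UNIV"
  by (simp add: seq_measure_def space_PiM)

lemma measurable_digit [measurable]: "(\<lambda>j. real (j k)) \<in> borel_measurable (seq_measure b)"
proof -
  have "(\<lambda>j. j k) \<in> seq_measure b \<rightarrow>\<^sub>M measure_pmf (pmf_of_set {0..<b})"
    unfolding seq_measure_def by (rule measurable_component_singleton) simp
  then show ?thesis
    by (rule measurable_compose) simp
qed

lemma measure_seq_measure_first_digit:
  assumes "0 < b" "E \<in> sets (seq_measure b)"
  shows "measure (seq_measure b) E = (\<Sum>a<b. measure (seq_measure b) (case_nat a -` E)) / real b"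
proof -
  interpret sequence_space "measure_pmf (pmf_of_set {0..<b})" by unfold_locales
  have "measure (seq_measure b) E
      = (\<integral>a. measure (seq_measure b) (case_nat a -` E) \<partial>measure_pmf (pmf_of_set {0..<b}))"
    using measure_S_eq_integral[of E] assms(2) by (simp add: seq_measure_def space_PiM)
  also have "\<dots> = (\<Sum>a<b. measure (seq_measure b) (case_nat a -` E)) / real b"
    using \<open>0 < b\<close> by (subst integral_pmf_of_set) (auto simp: lessThan_atLeast0)
  finally show ?thesis .
qed

lemma summable_geometric_mult:
  fixes f :: "nat \<Rightarrow> real"
  assumes "0 \<le> c" "c < 1" "\<And>n. \<bar>f n\<bar> \<le> D"
  shows "summable (\<lambda>n. c ^ n * f n)"
proof (rule summable_comparison_test')
  show "summable (\<lambda>n. c ^ n * D)" using assms by (intro summable_mult2 summable_geometric) auto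
  show "norm (c ^ n * f n) \<le> c ^ n * D" for n
    using assms by (auto simp: abs_mult intro!: mult_left_mono)
qed

lemma abs_suminf_geometric_mult_le:
  fixes f :: "nat \<Rightarrow> real"
  assumes "0 \<le> c" "c < 1" "\<And>n. \<bar>f n\<bar> \<le> D"
  shows "\<bar>\<Sum>n. c ^ n * f n\<bar> \<le> D / (1 - c)"
proof -
  have "norm (\<Sum>n. c ^ n * f n) \<le> (\<Sum>n. c ^ n * D)"
    using assms by (intro norm_suminf_le summable_mult2 summable_geometric)
      (auto simp: abs_mult intro!: mult_left_mono)
  also have "\<dots> = D / (1 - c)"
    using assms by (subst suminf_mult2[symmetric]) (auto simp: suminf_geometric summable_geometric)
  finally show ?thesis by simp
qed

locale weierstrass =
  fixes b :: nat and \<gamma> :: real and \<phi> :: "real \<Rightarrow> real" and L K :: real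
  assumes b_ge_2: "2 \<le> b" and \<gamma>_pos: "0 < \<gamma>" and \<gamma>_less_1: "\<gamma> < 1"
    and lipschitz: "L-lipschitz_on UNIV \<phi>" and bounded: "\<And>x. \<bar>\<phi> x\<bar> \<le> K"
begin

abbreviation \<Omega> :: "(nat \<Rightarrow> nat) measure" where
  "\<Omega> \<equiv> seq_measure b"

abbreviation S :: "real \<Rightarrow> (nat \<Rightarrow> nat) \<Rightarrow> real" where
  "S \<equiv> Sfun b \<gamma> \<phi>"

abbreviation \<mu> :: "real \<Rightarrow> real measure" where
  "\<mu> \<equiv> mx b \<gamma> \<phi>"

sublocale prob_space \<Omega>
  by (rule prob_space_seq_measure)

lemma b_pos: "0 < b" "0 < real b" "1 < real b"
  using b_ge_2 by auto

definition radius :: nat where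
  "radius = Suc (nat \<lfloor>K / (1 - \<gamma>)\<rfloor>)"

lemma abs_S_less: "\<bar>S x j\<bar> < real radius"
proof -
  have "\<bar>S x j\<bar> \<le> K / (1 - \<gamma>)"
    unfolding Sfun_def using \<gamma>_pos \<gamma>_less_1 bounded by (intro abs_suminf_geometric_mult_le) auto
  also have "\<dots> < real radius" unfolding radius_def by linarith
  finally show ?thesis .
qed

definition lip_const :: real where
  "lip_const = L / (1 - \<gamma>)"

lemma lip_const_nonneg: "0 \<le> lip_const"
  using lipschitz_on_nonneg[OF lipschitz] \<gamma>_less_1 by (simp add: lip_const_def)

lemma dist_S_le: "dist (S x j) (S y j) \<le> lip_const * \<bar>x - y\<bar>"
proof -
  define t where "t n = (\<Sum>k<Suc n. real (j k) * real b ^ k)" for n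
  define d where "d n = \<phi> ((x + t n) / real b ^ Suc n) - \<phi> ((y + t n) / real b ^ Suc n)" for n
  have "\<bar>d n\<bar> \<le> L * \<bar>x - y\<bar>" for n
  proof -
    have "\<bar>d n\<bar> \<le> L * \<bar>(x + t n) / real b ^ Suc n - (y + t n) / real b ^ Suc n\<bar>"
      unfolding d_def using lipschitz_onD[OF lipschitz] by (simp add: dist_real_def)
    also have "\<dots> = L * (\<bar>x - y\<bar> / real b ^ Suc n)"
      by (simp add: diff_divide_distrib[symmetric] abs_mult)
    also have "\<dots> \<le> L * (\<bar>x - y\<bar> / 1)"
      using b_pos
      by (intro mult_left_mono divide_left_mono one_le_power lipschitz_on_nonneg[OF lipschitz]) auto
    finally show ?thesis by simp
  qed
  then have "\<bar>\<Sum>n. \<gamma> ^ n * d n\<bar> \<le> L * \<bar>x - y\<bar> / (1 - \<gamma>)"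
    using \<gamma>_pos \<gamma>_less_1 by (intro abs_suminf_geometric_mult_le) auto
  moreover have "S x j - S y j = (\<Sum>n. \<gamma> ^ n * d n)"
    unfolding Sfun_def t_def[symmetric] d_def right_diff_distrib using \<gamma>_pos \<gamma>_less_1 bounded
    by (intro suminf_diff summable_geometric_mult) auto
  ultimately show ?thesis by (simp add: dist_real_def lip_const_def)
qed

lemma S_case_nat: "S x (case_nat a j) = \<phi> ((x + real a) / real b) + \<gamma> * S ((x + real a) / real b) j"
proof -
  define y where "y = (x + real a) / real b"
  define f
    where "f n = \<phi> ((x + (\<Sum>k<Suc n. real (case_nat a j k) * real b ^ k)) / real b ^ Suc n)" for n
  have summable: "summable (\<lambda>n. \<gamma> ^ n * \<phi> (g n))" for g
    using \<gamma>_pos \<gamma>_less_1 bounded by (intro summable_geometric_mult) auto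
  have f_Suc: "f (Suc n) = \<phi> ((y + (\<Sum>k<Suc n. real (j k) * real b ^ k)) / real b ^ Suc n)" for n
  proof -
    have "(\<Sum>k<Suc (Suc n). real (case_nat a j k) * real b ^ k)
        = real a + real b * (\<Sum>k<Suc n. real (j k) * real b ^ k)"
      by (subst sum.lessThan_Suc_shift) (simp add: sum_distrib_left mult.left_commute distrib_left)
    moreover have "(x + (real a + real b * t)) / real b ^ Suc (Suc n)
        = (y + t) / real b ^ Suc n" for t
      using b_pos by (simp add: y_def field_simps)
    ultimately show ?thesis by (simp add: f_def)
  qed
  have "S x (case_nat a j) = (\<Sum>n. \<gamma> ^ n * f n)" by (simp add: Sfun_def f_def)
  also have "\<dots> = f 0 + (\<Sum>n. \<gamma> ^ Suc n * f (Suc n))"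
    using suminf_split_head[of "\<lambda>n. \<gamma> ^ n * f n"] summable by (simp add: f_def)
  also have "(\<Sum>n. \<gamma> ^ Suc n * f (Suc n)) = \<gamma> * S y j"
    unfolding f_Suc Sfun_def power_Suc mult.assoc by (rule suminf_mult[OF summable])
  finally show ?thesis by (simp add: f_def y_def)
qed

section \<open>Self-similarity of the measures m_x\<close>

lemma borel_measurable_S_pair: "(\<lambda>(x, j). S x j) \<in> borel_measurable (borel \<Otimes>\<^sub>M \<Omega>)"
proof -
  have [measurable]: "\<phi> \<in> borel_measurable borel"
    using lipschitz by (intro borel_measurable_continuous_onI lipschitz_on_continuous_on)
  show ?thesis unfolding Sfun_def by measurable
qed

lemma borel_measurable_S [measurable]: "S x \<in> borel_measurable \<Omega>"
  using measurable_compose_Pair1[OF _ borel_measurable_S_pair, of x] by simp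

lemma measurable_mu: "\<mu> \<in> borel \<rightarrow>\<^sub>M subprob_algebra borel"
proof -
  have "\<Omega> \<in> space (subprob_algebra \<Omega>)"
    by (simp add: space_subprob_algebra prob_space_imp_subprob_space prob_space_axioms)
  then show ?thesis
    unfolding mx_def[abs_def] using borel_measurable_S_pair
    by (intro measurable_distr2[where M=\<Omega>] measurable_const)
qed

lemma measure_mu: "E \<in> sets borel \<Longrightarrow> measure (\<mu> x) E = prob (S x -` E)"
  unfolding mx_def by (subst measure_distr) auto

sublocale mu: bounded_badic_measure "\<mu> x" b radius for x
proof -
  interpret P: real_distribution "\<mu> x"
    unfolding mx_def by (rule real_distribution_distr) simp
  have "AE y in \<mu> x. \<bar>y\<bar> < real radius"
    unfolding mx_def using abs_S_less by (subst AE_distr_iff) auto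
  then show "bounded_badic_measure (\<mu> x) b radius"
    by unfold_locales (rule b_ge_2)
qed

lemma measure_mu_first_digit:
  assumes "E \<in> sets borel"
  shows "measure (\<mu> x) E = (\<Sum>a<b. measure (\<mu> ((x + real a) / real b))
    ((\<lambda>t. \<phi> ((x + real a) / real b) + \<gamma> * t) -` E)) / real b"
proof -
  have "S x -` E \<in> events"
    using measurable_sets[OF borel_measurable_S assms, of x] by simp
  then show ?thesis
    using b_pos assms
    by (simp add: measure_mu affine_vimage_borel measure_seq_measure_first_digit vimage_def
        S_case_nat)
qed

primrec offset :: "nat list \<Rightarrow> real \<Rightarrow> real" where
  "offset [] x = 0"
| "offset (a # u) x = \<phi> ((x + real a) / real b) + \<gamma> * offset u ((x + real a) / real b)"

definition piece :: "nat list \<Rightarrow> real \<Rightarrow> real measure" where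
  "piece u x = distr (\<mu> (word_map b u x)) borel (\<lambda>t. offset u x + \<gamma> ^ length u * t)"

sublocale piece: badic_measure "piece u x" b for u x
proof -
  interpret P: real_distribution "piece u x"
    unfolding piece_def by (rule mu.real_distribution_distr) simp
  show "badic_measure (piece u x) b"
    by unfold_locales (rule b_ge_2)
qed

lemma measure_piece:
  "E \<in> sets borel \<Longrightarrow> measure (piece u x) E
    = measure (\<mu> (word_map b u x)) ((\<lambda>t. offset u x + \<gamma> ^ length u * t) -` E)"
  unfolding piece_def by (subst measure_distr) auto

lemma measure_mu_eq_word_avg:
  "E \<in> sets borel \<Longrightarrow> measure (\<mu> x) E = word_avg b p (\<lambda>u. measure (piece u x) E)"
proof (induction p arbitrary: x E)
  case 0
  then show ?case by (simp add: measure_piece)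
next
  case (Suc p)
  define y where "y a = (x + real a) / real b" for a
  define E' where "E' a = (\<lambda>t. \<phi> (y a) + \<gamma> * t) -` E" for a
  have borel_E': "E' a \<in> sets borel" for a
    unfolding E'_def using Suc.prems by (rule affine_vimage_borel)
  have "measure (piece u (y a)) (E' a) = measure (piece (a # u) x) E" for a u
    using b_pos borel_E' Suc.prems by (simp add: measure_piece word_map_Cons y_def)
      (simp add: E'_def y_def vimage_def distrib_left mult.assoc add.assoc)
  then have "(\<Sum>a<b. measure (\<mu> (y a)) (E' a))
      = (\<Sum>a<b. word_avg b p (\<lambda>u. measure (piece (a # u) x) E))"
    by (simp add: Suc.IH[OF borel_E'])
  then show ?case
    using Suc.prems by (simp add: measure_mu_first_digit word_avg_Suc y_def E'_def)
qed

lemma cell_prob_mu: "mu.cell_prob x i c = word_avg b p (\<lambda>u. piece.cell_prob u x i c)"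
  unfolding mu.cell_prob_def piece.cell_prob_def by (rule measure_mu_eq_word_avg) simp

lemma word_avg_cond_entropy_piece_le:
  "word_avg b p (\<lambda>u. piece.cond_entropy u x i m c) \<le> mu.cond_entropy x i m c"
proof -
  let ?t = "\<lambda>d u. piece.cell_prob u x (i + m) d" and ?s = "\<lambda>u. piece.cell_prob u x i c"
  have "word_avg b p (\<lambda>u. ?t d u * log (real b) (?s u / ?t d u))
      \<le> mu.cell_prob x (i + m) d * log (real b) (mu.cell_prob x i c / mu.cell_prob x (i + m) d)"
    if child: "d \<in> children b m c" for d
  proof -
    have "(\<Sum>u\<in>words b p. ?t d u * log (real b) (?s u / ?t d u))
        \<le> sum (?t d) (words b p) * log (real b) (sum ?s (words b p) / sum (?t d) (words b p))"
    proof (rule log_sum_inequality)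
      show "0 < ?s u" if "0 < ?t d u" for u
        using that piece.cell_prob_child_le[OF child, of u x i] by (rule less_le_trans)
    qed (use b_pos in auto)
    then have "word_avg b p (\<lambda>u. ?t d u * log (real b) (?s u / ?t d u))
        \<le> sum (?t d) (words b p) * log (real b) (sum ?s (words b p) / sum (?t d) (words b p))
          / real b ^ p"
      unfolding word_avg_def by (rule divide_right_mono) simp
    then show ?thesis
      using b_pos by (simp add: cell_prob_mu[where p=p] word_avg_def)
  qed
  then show ?thesis
    unfolding mu.cond_entropy_def piece.cond_entropy_def word_avg_sum by (rule sum_mono)
qed

section \<open>Entropy bounds for the measures m_x\<close>

definition generation :: "nat \<Rightarrow> nat" where
  "generation i = (LEAST p. \<gamma> ^ p * real b ^ i \<le> 1)"

lemma generation_le: "\<gamma> ^ generation i * real b ^ i \<le> 1"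
proof -
  obtain p where "\<gamma> ^ p < 1 / real b ^ i"
    using real_arch_pow_inv[of "1 / real b ^ i" \<gamma>] b_pos \<gamma>_less_1 by auto
  then have "\<gamma> ^ p * real b ^ i \<le> 1" using b_pos by (simp add: field_simps)
  then show ?thesis unfolding generation_def by (rule LeastI)
qed

lemma generation_ge: "\<gamma> \<le> \<gamma> ^ generation i * real b ^ i"
proof (cases "generation i")
  case 0
  have "1 \<le> real b ^ i" using b_pos by (intro one_le_power) simp
  then show ?thesis using 0 \<gamma>_less_1 by simp
next
  case (Suc p)
  then have "\<not> \<gamma> ^ p * real b ^ i \<le> 1"
    using not_less_Least[of p "\<lambda>p. \<gamma> ^ p * real b ^ i \<le> 1"] by (simp add: generation_def)
  then have "\<gamma> * 1 \<le> \<gamma> * (\<gamma> ^ p * real b ^ i)" using \<gamma>_pos by (intro mult_left_mono) auto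
  then show ?thesis using Suc by (simp add: mult.assoc)
qed

text \<open>The pieces of the generation of level i are about as long as the cells of level i, so each of
  them meets boundedly many cells and cutting it along the cells costs a bounded amount of entropy.\<close>

lemma card_charged_cells_piece_le:
  assumes "length u = generation i" "finite X"
  shows "card {c \<in> X. 0 < piece.cell_prob u x i c} \<le> 2 * radius + 1"
  using \<open>finite X\<close>
proof (rule piece.card_charged_cells_le)
  have "real b ^ i * \<bar>\<gamma> ^ length u * t\<bar> \<le> real radius" if "\<bar>t\<bar> < real radius" for t
  proof -
    have "real b ^ i * \<bar>\<gamma> ^ length u * t\<bar> = (\<gamma> ^ generation i * real b ^ i) * \<bar>t\<bar>"
      using \<gamma>_pos assms(1) by (simp add: abs_mult)
    also have "\<dots> \<le> 1 * real radius"
      using generation_le that by (intro mult_mono) auto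
    finally show ?thesis by simp
  qed
  then show "AE y in piece u x. real b ^ i * \<bar>y - offset u x\<bar> \<le> real radius"
    unfolding piece_def using mu.AE_abs_less[of "word_map b u x"]
    by (subst AE_distr_iff) auto
qed

lemma heavy_mass_piece_le:
  assumes "length u = generation i"
  shows "heavy_mass (piece u x) (1 / real b ^ (i + m)) t
    \<le> heavy_mass (\<mu> (word_map b u x)) (1 / (\<gamma> * real b ^ m)) t"
proof -
  let ?\<rho> = "\<gamma> ^ length u"
  have "heavy_mass (piece u x) r t
      = heavy_mass (distr (\<mu> (word_map b u x)) borel (\<lambda>t. t)) (r / ?\<rho>) t" for r
    unfolding piece_def
  proof (rule mu.ball_mass_prob_distr_similarity)
    show "dist (offset u x + ?\<rho> * s) (offset u x + ?\<rho> * s') = ?\<rho> * dist s s'" for s s'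
      using \<gamma>_pos by (simp add: dist_real_def right_diff_distrib[symmetric] abs_mult)
  qed (use \<gamma>_pos in auto)
  moreover have "distr (\<mu> y) borel (\<lambda>t. t) = \<mu> y" for y
    by (rule distr_id2) simp
  moreover have "1 / real b ^ (i + m) / ?\<rho> \<le> 1 / (\<gamma> * real b ^ m)"
  proof -
    have "\<gamma> * real b ^ m \<le> (?\<rho> * real b ^ i) * real b ^ m"
      using generation_ge[of i] assms by (intro mult_right_mono) auto
    then show ?thesis
      using \<gamma>_pos b_pos by (simp add: power_add divide_left_mono mult_ac)
  qed
  ultimately show ?thesis by (simp add: mu.heavy_mass_mono)
qed

definition piece_heavy_mass :: "nat \<Rightarrow> nat \<Rightarrow> real \<Rightarrow> real \<Rightarrow> real" where
  "piece_heavy_mass i m t x = word_avg b (generation i)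
     (\<lambda>u. heavy_mass (\<mu> (word_map b u x)) (1 / (\<gamma> * real b ^ m)) t)"

definition cutting_cost :: real where
  "cutting_cost = real (2 * radius + 1) / ln (real b)"

lemma piece_heavy_mass_nonneg: "0 \<le> piece_heavy_mass i m t x"
  unfolding piece_heavy_mass_def word_avg_def
  by (intro divide_nonneg_nonneg sum_nonneg ball_mass_prob_nonneg) simp

lemma sum_cond_entropy_mu_ge:
  assumes "finite X"
  shows "\<kappa> * (\<Sum>c\<in>X. mu.cell_prob x i c)
      - max 0 \<kappa> * piece_heavy_mass i m (real b powr - \<kappa>) x - cutting_cost
    \<le> (\<Sum>c\<in>X. mu.cond_entropy x i m c)"
proof -
  let ?p = "generation i" and ?t = "real b powr - \<kappa>"
  let ?heavy = "\<lambda>u. heavy_mass (\<mu> (word_map b u x)) (1 / (\<gamma> * real b ^ m)) ?t"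
  have piece: "\<kappa> * (\<Sum>c\<in>X. piece.cell_prob u x i c) - max 0 \<kappa> * ?heavy u - cutting_cost
      \<le> (\<Sum>c\<in>X. piece.cond_entropy u x i m c)" if "u \<in> words b ?p" for u
  proof -
    have "max 0 \<kappa> * heavy_mass (piece u x) (1 / real b ^ (i + m)) ?t \<le> max 0 \<kappa> * ?heavy u"
      using length_words[OF that] by (intro mult_left_mono heavy_mass_piece_le) auto
    then show ?thesis
      using piece.sum_cond_entropy_ge[OF assms
          card_charged_cells_piece_le[OF length_words[OF that] assms], of \<kappa> x m]
      by (simp add: cutting_cost_def)
  qed
  have "\<kappa> * (\<Sum>c\<in>X. mu.cell_prob x i c) - max 0 \<kappa> * piece_heavy_mass i m ?t x - cutting_cost
      = word_avg b ?p (\<lambda>u. \<kappa> * (\<Sum>c\<in>X. piece.cell_prob u x i c) - max 0 \<kappa> * ?heavy u - cutting_cost)"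
    using b_pos
    by (simp add: cell_prob_mu[where p="?p"] piece_heavy_mass_def word_avg_diff word_avg_cmult
        word_avg_const word_avg_sum)
  also have "\<dots> \<le> word_avg b ?p (\<lambda>u. \<Sum>c\<in>X. piece.cond_entropy u x i m c)"
    by (rule word_avg_mono) (rule piece)
  also have "\<dots> \<le> (\<Sum>c\<in>X. mu.cond_entropy x i m c)"
    unfolding word_avg_sum by (intro sum_mono word_avg_cond_entropy_piece_le)
  finally show ?thesis .
qed

lemma high_entropy_mass_mu_le:
  assumes "0 < m" "\<tau> \<le> \<alpha>" "\<tau> \<le> 1"
  shows "real m * \<tau> + real m * \<epsilon> * mu.high_entropy_mass x (\<alpha> + \<epsilon>) m i
    \<le> mu.level_entropy x (i + m) - mu.level_entropy x i
      + (real m * piece_heavy_mass i m (real b powr - (real m * \<tau>)) x + cutting_cost)"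
  using assms(1,2)
proof (rule mu.high_entropy_mass_le_level_entropy_diff)
  let ?heavy = "piece_heavy_mass i m (real b powr - (real m * \<tau>)) x"
  fix X assume "X \<subseteq> mu.cells i"
  then have "finite X" by (rule finite_subset) simp
  have "real m * \<tau> \<le> real m * 1" using \<open>\<tau> \<le> 1\<close> by (rule mult_left_mono) simp
  then have "max 0 (real m * \<tau>) * ?heavy \<le> real m * ?heavy"
    by (intro mult_right_mono piece_heavy_mass_nonneg) simp
  then show "real m * \<tau> * (\<Sum>c\<in>X. mu.cell_prob x i c) - (real m * ?heavy + cutting_cost)
      \<le> (\<Sum>c\<in>X. mu.cond_entropy x i m c)"
    using sum_cond_entropy_mu_ge[OF \<open>finite X\<close>, of "real m * \<tau>" x i m] by linarith
qed

lemma sum_high_entropy_mass_mu_le: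
  assumes "0 < m" "\<tau> \<le> \<alpha>" "\<tau> \<le> 1"
  shows "real k * (real m * \<tau>) + real m * \<epsilon> * (\<Sum>i=1..k. mu.high_entropy_mass x (\<alpha> + \<epsilon>) m i)
    \<le> (\<Sum>i=k+1..k+m. mu.level_entropy x i)
      + real m * (\<Sum>i=1..k. piece_heavy_mass i m (real b powr - (real m * \<tau>)) x)
      + real k * cutting_cost"
proof -
  let ?heavy = "\<lambda>i. piece_heavy_mass i m (real b powr - (real m * \<tau>)) x"
  have "real k * (real m * \<tau>) + real m * \<epsilon> * (\<Sum>i=1..k. mu.high_entropy_mass x (\<alpha> + \<epsilon>) m i)
      = (\<Sum>i=1..k. real m * \<tau> + real m * \<epsilon> * mu.high_entropy_mass x (\<alpha> + \<epsilon>) m i)"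
    by (simp add: sum.distrib sum_distrib_left)
  also have "\<dots> \<le> (\<Sum>i=1..k. mu.level_entropy x (i + m) - mu.level_entropy x i
      + (real m * ?heavy i + cutting_cost))"
    by (intro sum_mono high_entropy_mass_mu_le assms)
  also have "\<dots> = (\<Sum>i=1..k. mu.level_entropy x (i + m) - mu.level_entropy x i)
      + real m * (\<Sum>i=1..k. ?heavy i) + real k * cutting_cost"
    by (simp add: sum.distrib sum_distrib_left)
  also have "(\<Sum>i=1..k. mu.level_entropy x (i + m) - mu.level_entropy x i)
      \<le> (\<Sum>i=k+1..k+m. mu.level_entropy x i)"
    by (rule sum_shift_diff_le) (rule mu.level_entropy_nonneg)
  finally show ?thesis by simp
qed

section \<open>Averaging over words\<close>

lemma heavy_mass_mu_perturb:
  "lip_const * \<bar>x - z\<bar> \<le> s \<Longrightarrow> heavy_mass (\<mu> x) r t \<le> heavy_mass (\<mu> z) (r + 2 * s) t"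
  unfolding mx_def by (intro heavy_mass_distr_perturb order_trans[OF dist_S_le]) auto

lemma light_mass_mu_perturb:
  "lip_const * \<bar>x - z\<bar> \<le> s \<Longrightarrow> light_mass (\<mu> x) (r + 2 * s) t \<le> light_mass (\<mu> z) r t"
  unfolding mx_def by (intro light_mass_distr_perturb order_trans[OF dist_S_le]) auto

lemma word_avg_ball_mass_prob_le:
  assumes [measurable]: "U \<in> sets borel"
    and perturb: "\<And>x z. lip_const * \<bar>x - z\<bar> \<le> lip_const / real b ^ n
      \<Longrightarrow> ball_mass_prob (\<mu> x) r U \<le> ball_mass_prob (\<mu> z) r' U"
  shows "word_avg b n (\<lambda>w. ball_mass_prob (\<mu> (word_map b w 0)) r U)
    \<le> (\<integral>z. ball_mass_prob (\<mu> z) r' U \<partial>unif)"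
proof (rule word_avg_le_integral)
  show "(\<lambda>z. ball_mass_prob (\<mu> z) r' U) \<in> borel_measurable borel"
    by (rule borel_measurable_ball_mass_prob[OF measurable_mu]) measurable
  show "\<bar>ball_mass_prob (\<mu> z) r' U\<bar> \<le> 1" for z
    by (rule abs_ball_mass_prob_le_1) (rule mu.prob_space_axioms)
  fix x z :: real assume "\<bar>x - z\<bar> \<le> 1 / real b ^ n"
  then have "lip_const * \<bar>x - z\<bar> \<le> lip_const * (1 / real b ^ n)"
    by (intro mult_left_mono lip_const_nonneg)
  then show "ball_mass_prob (\<mu> x) r U \<le> ball_mass_prob (\<mu> z) r' U"
    by (intro perturb) simp
qed (rule b_pos)

lemma word_avg_heavy_mass_le:
  assumes "lip_const / real b ^ n \<le> s"
  shows "word_avg b n (\<lambda>w. heavy_mass (\<mu> (word_map b w 0)) r t)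
    \<le> (\<integral>z. heavy_mass (\<mu> z) (r + 2 * s) t \<partial>unif)"
  using assms by (intro word_avg_ball_mass_prob_le heavy_mass_mu_perturb) auto

lemma word_avg_light_mass_le:
  assumes "lip_const / real b ^ n \<le> s"
  shows "word_avg b n (\<lambda>w. light_mass (\<mu> (word_map b w 0)) (r + 2 * s) t)
    \<le> (\<integral>z. light_mass (\<mu> z) r t \<partial>unif)"
  using assms by (intro word_avg_ball_mass_prob_le light_mass_mu_perturb) auto

definition mean_heavy_mass :: "real \<Rightarrow> nat \<Rightarrow> real" where
  "mean_heavy_mass \<tau> m =
    (\<integral>z. heavy_mass (\<mu> z) (2 / \<gamma> / real b ^ m) (real b powr - (real m * \<tau>)) \<partial>unif)"

definition mean_light_mass :: "real \<Rightarrow> nat \<Rightarrow> real" where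
  "mean_light_mass \<sigma> i =
    (\<integral>z. light_mass (\<mu> z) (1 / 2 / real b ^ i) (real b powr - (real i * \<sigma>)) \<partial>unif)"

definition mean_high_entropy_mass :: "real \<Rightarrow> nat \<Rightarrow> nat \<Rightarrow> nat \<Rightarrow> real" where
  "mean_high_entropy_mass h m k n =
    word_avg b n (\<lambda>w. \<Sum>i=1..k. mu.high_entropy_mass (word_map b w 0) h m i)"

definition resolves :: "nat \<Rightarrow> nat \<Rightarrow> bool" where
  "resolves n i \<longleftrightarrow> lip_const / real b ^ n \<le> 1 / (4 * real b ^ i)"

lemma resolves_mono:
  assumes "resolves n j" "i \<le> j"
  shows "resolves n i"
proof -
  have "1 / (4 * real b ^ j) \<le> 1 / (4 * real b ^ i)"
    using assms(2) b_pos by (intro divide_left_mono mult_left_mono power_increasing) auto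
  then show ?thesis using assms(1) by (simp add: resolves_def)
qed

lemma eventually_resolves: "\<forall>\<^sub>F n in sequentially. resolves n i"
  unfolding resolves_def using b_pos by real_asymp

lemma word_avg_piece_heavy_mass_le:
  assumes "resolves n m"
  shows "word_avg b n (\<lambda>w. piece_heavy_mass i m (real b powr - (real m * \<tau>)) (word_map b w 0))
    \<le> mean_heavy_mass \<tau> m"
proof -
  let ?t = "real b powr - (real m * \<tau>)" and ?s = "1 / (2 * \<gamma> * real b ^ m)"
  have "real b ^ n \<le> real b ^ (n + generation i)"
    using b_pos by (intro power_increasing) auto
  then have "lip_const / real b ^ (n + generation i) \<le> lip_const / real b ^ n"
    using b_pos by (intro divide_left_mono lip_const_nonneg) auto
  also have "\<dots> \<le> 1 / (4 * real b ^ m)"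
    using assms by (simp only: resolves_def)
  also have "\<dots> \<le> ?s"
    using \<gamma>_pos \<gamma>_less_1 b_pos by (intro divide_left_mono) auto
  finally have "word_avg b (n + generation i)
        (\<lambda>w. heavy_mass (\<mu> (word_map b w 0)) (1 / (\<gamma> * real b ^ m)) ?t)
      \<le> (\<integral>z. heavy_mass (\<mu> z) (1 / (\<gamma> * real b ^ m) + 2 * ?s) ?t \<partial>unif)"
    by (rule word_avg_heavy_mass_le)
  then show ?thesis
    using b_pos
    by (simp add: mean_heavy_mass_def piece_heavy_mass_def word_avg_add_length word_map_append)
qed

lemma word_avg_level_entropy_le:
  assumes "0 \<le> \<sigma>" "resolves n i"
  shows "word_avg b n (\<lambda>w. mu.level_entropy (word_map b w 0) i)
    \<le> real i * \<sigma> + log (real b) 6 + mean_light_mass \<sigma> i * mu.log_cell_count i"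
proof -
  let ?K = "real i * \<sigma> + log (real b) 6"
  let ?light = "\<lambda>x. light_mass (\<mu> x) (1 / real b ^ i) (real b powr - (real i * \<sigma>))"
  have "word_avg b n (\<lambda>w. mu.level_entropy (word_map b w 0) i)
      \<le> word_avg b n (\<lambda>w. ?K + mu.log_cell_count i * ?light (word_map b w 0))"
    using mu.level_entropy_le[of "real i * \<sigma>"] \<open>0 \<le> \<sigma>\<close>
    by (intro word_avg_mono) (simp add: mult.commute)
  also have "\<dots> = ?K + mu.log_cell_count i * word_avg b n (\<lambda>w. ?light (word_map b w 0))"
    using b_pos by (simp add: word_avg_add word_avg_cmult word_avg_const)
  also have "\<dots> \<le> ?K + mu.log_cell_count i * mean_light_mass \<sigma> i"
    unfolding mean_light_mass_def
    using word_avg_light_mass_le[OF assms(2)[unfolded resolves_def], of "1 / 2 / real b ^ i"]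
    by (intro add_left_mono mult_left_mono mu.log_cell_count_nonneg) simp
  finally show ?thesis by (simp only: mult.commute)
qed

lemma word_avg_level_entropy_le_uniform:
  assumes "0 \<le> \<sigma>" "0 \<le> e" "resolves n j" "i \<le> j" "mean_light_mass \<sigma> i \<le> e"
  shows "word_avg b n (\<lambda>w. mu.level_entropy (word_map b w 0) i)
    \<le> real j * \<sigma> + log (real b) 6 + e * mu.log_cell_count j"
proof -
  have "mean_light_mass \<sigma> i * mu.log_cell_count i \<le> e * mu.log_cell_count j"
    using assms by (intro mult_mono mu.log_cell_count_mono mu.log_cell_count_nonneg)
  moreover have "real i * \<sigma> \<le> real j * \<sigma>"
    using assms by (intro mult_right_mono) auto
  ultimately show ?thesis
    using word_avg_level_entropy_le[OF assms(1) resolves_mono[OF assms(3,4)]] by linarith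
qed

lemma mean_high_entropy_mass_le:
  assumes "\<tau> \<le> \<alpha>" "\<tau> \<le> 1" "0 < m" "resolves n m"
    and level_entropy: "\<And>i. k < i \<Longrightarrow> i \<le> k + m
      \<Longrightarrow> word_avg b n (\<lambda>w. mu.level_entropy (word_map b w 0) i) \<le> E"
  shows "real k * (real m * \<tau>) + real m * \<epsilon> * mean_high_entropy_mass (\<alpha> + \<epsilon>) m k n
    \<le> real m * E + real k * (real m * mean_heavy_mass \<tau> m) + real k * cutting_cost"
proof -
  let ?high = "\<lambda>x i. mu.high_entropy_mass x (\<alpha> + \<epsilon>) m i"
    and ?heavy = "\<lambda>x i. piece_heavy_mass i m (real b powr - (real m * \<tau>)) x"
    and ?avg = "\<lambda>f. word_avg b n (\<lambda>w. f (word_map b w 0))"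
  have "real k * (real m * \<tau>) + real m * \<epsilon> * mean_high_entropy_mass (\<alpha> + \<epsilon>) m k n
      = ?avg (\<lambda>x. real k * (real m * \<tau>) + real m * \<epsilon> * (\<Sum>i=1..k. ?high x i))"
    using b_pos by (simp add: mean_high_entropy_mass_def word_avg_add word_avg_cmult word_avg_const)
  also have "\<dots> \<le> ?avg (\<lambda>x. (\<Sum>i=k+1..k+m. mu.level_entropy x i)
      + real m * (\<Sum>i=1..k. ?heavy x i) + real k * cutting_cost)"
    by (intro word_avg_mono sum_high_entropy_mass_mu_le assms)
  also have "\<dots> = (\<Sum>i=k+1..k+m. ?avg (\<lambda>x. mu.level_entropy x i))
      + real m * (\<Sum>i=1..k. ?avg (\<lambda>x. ?heavy x i)) + real k * cutting_cost"
    using b_pos by (simp only: word_avg_add word_avg_cmult word_avg_const word_avg_sum)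
  also have "\<dots> \<le> (\<Sum>i=k+1..k+m. E) + real m * (\<Sum>i=1..k. mean_heavy_mass \<tau> m) + real k * cutting_cost"
    using level_entropy word_avg_piece_heavy_mass_le[OF assms(4)]
    by (intro add_right_mono add_mono sum_mono mult_left_mono) auto
  finally show ?thesis by (simp add: algebra_simps)
qed

lemma integral_ball_mass_prob_tendsto_0:
  assumes exact: "AE x in lborel. x \<in> {0..1} \<longrightarrow> exact_dimensional (\<mu> x) \<alpha>"
    and [measurable]: "\<And>n. U n \<in> sets borel"
    and lim: "\<And>x. exact_dimensional (\<mu> x) \<alpha> \<Longrightarrow> (\<lambda>n. ball_mass_prob (\<mu> x) (r n) (U n)) \<longlonglongrightarrow> 0"
  shows "(\<lambda>n. \<integral>z. ball_mass_prob (\<mu> z) (r n) (U n) \<partial>unif) \<longlonglongrightarrow> 0"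
proof (rule prob_space.expectation_tendsto_0[OF prob_space_unif, where B=1])
  show "(\<lambda>z. ball_mass_prob (\<mu> z) (r n) (U n)) \<in> borel_measurable unif" for n
    using borel_measurable_ball_mass_prob[OF measurable_mu] by simp
  show "\<bar>ball_mass_prob (\<mu> z) (r n) (U n)\<bar> \<le> 1" for n z
    by (rule abs_ball_mass_prob_le_1) (rule mu.prob_space_axioms)
  have "AE z in lborel. z \<in> {0..<1} \<longrightarrow> (\<lambda>n. ball_mass_prob (\<mu> z) (r n) (U n)) \<longlonglongrightarrow> 0"
    using exact by eventually_elim (auto intro: lim)
  then show "AE z in unif. (\<lambda>n. ball_mass_prob (\<mu> z) (r n) (U n)) \<longlonglongrightarrow> 0"
    by (intro AE_uniform_measureI) auto
qed

lemma mean_heavy_mass_tendsto_0: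
  assumes "AE x in lborel. x \<in> {0..1} \<longrightarrow> exact_dimensional (\<mu> x) \<alpha>" "\<tau> < \<alpha>"
  shows "mean_heavy_mass \<tau> \<longlonglongrightarrow> 0"
  unfolding mean_heavy_mass_def[abs_def] using assms(1)
proof (rule integral_ball_mass_prob_tendsto_0)
  show "(\<lambda>n. heavy_mass (\<mu> x) (2 / \<gamma> / real b ^ n) (real b powr - (real n * \<tau>))) \<longlonglongrightarrow> 0"
    if "exact_dimensional (\<mu> x) \<alpha>" for x
    using that \<gamma>_pos b_pos(3) \<open>\<tau> < \<alpha>\<close> by (intro mu.heavy_mass_tendsto_0) simp_all
qed simp

lemma mean_light_mass_tendsto_0:
  assumes "AE x in lborel. x \<in> {0..1} \<longrightarrow> exact_dimensional (\<mu> x) \<alpha>" "\<alpha> < \<sigma>"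
  shows "mean_light_mass \<sigma> \<longlonglongrightarrow> 0"
  unfolding mean_light_mass_def[abs_def] using assms(1)
proof (rule integral_ball_mass_prob_tendsto_0)
  show "(\<lambda>n. light_mass (\<mu> x) (1 / 2 / real b ^ n) (real b powr - (real n * \<sigma>))) \<longlonglongrightarrow> 0"
    if "exact_dimensional (\<mu> x) \<alpha>" for x
    using that b_pos(3) \<open>\<alpha> < \<sigma>\<close> by (intro mu.light_mass_tendsto_0) simp_all
qed simp

lemma mean_high_entropy_mass_less:
  assumes "0 \<le> \<alpha>" "\<alpha> \<le> 1" "0 < e" "0 < m" "0 < k" "resolves n (k + m)"
    and cost: "cutting_cost \<le> e * real m" and heavy: "mean_heavy_mass (\<alpha> - e) m \<le> e"
    and light: "\<And>i. k \<le> i \<Longrightarrow> mean_light_mass (\<alpha> + e) i \<le> e"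
    and large: "real m * (\<alpha> + e) + log (real b) 6 \<le> e * real k" "mu.log_cell_count m \<le> real k"
  shows "\<epsilon> * mean_high_entropy_mass (\<alpha> + \<epsilon>) m k n < 8 * (e * real k)"
proof -
  let ?V = "mean_high_entropy_mass (\<alpha> + \<epsilon>) m k n"
  define E where "E = real (k + m) * (\<alpha> + e) + log (real b) 6 + e * mu.log_cell_count (k + m)"
  have "word_avg b n (\<lambda>w. mu.level_entropy (word_map b w 0) i) \<le> E" if "k < i" "i \<le> k + m" for i
    unfolding E_def using that assms by (intro word_avg_level_entropy_le_uniform light) auto
  then have "real k * (real m * (\<alpha> - e)) + real m * \<epsilon> * ?V
      \<le> real m * E + real k * (real m * mean_heavy_mass (\<alpha> - e) m) + real k * cutting_cost"
    using assms resolves_mono[OF assms(6), of m] by (intro mean_high_entropy_mass_le) auto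
  also have "\<dots> \<le> real m * E + real k * (real m * e) + real k * (e * real m)"
    using cost heavy by (intro add_mono mult_left_mono) auto
  finally have "real m * (real k * (\<alpha> - e) + \<epsilon> * ?V) \<le> real m * (E + 2 * (e * real k))"
    by (simp add: algebra_simps)
  then have "real k * (\<alpha> - e) + \<epsilon> * ?V \<le> E + 2 * (e * real k)"
    using \<open>0 < m\<close> by (subst (asm) mult_le_cancel_left_pos) auto
  moreover have "e * mu.log_cell_count m \<le> e * real k"
    using large(2) \<open>0 < e\<close> by (intro mult_left_mono) auto
  ultimately have "\<epsilon> * ?V \<le> 7 * (e * real k)"
    using large(1) by (simp add: E_def mu.log_cell_count_add algebra_simps)
  also have "\<dots> < 8 * (e * real k)" using \<open>0 < k\<close> \<open>0 < e\<close> by simp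
  finally show ?thesis .
qed

lemma eventually_mean_high_entropy_mass_less:
  assumes AE: "AE x in lborel. x \<in> {0..1} \<longrightarrow> exact_dimensional (\<mu> x) \<alpha>"
    and "0 \<le> \<alpha>" "\<alpha> \<le> 1" "0 < \<epsilon>" "0 < \<delta>"
  shows "\<forall>\<^sub>F m in sequentially. \<forall>\<^sub>F k in sequentially. \<forall>\<^sub>F n in sequentially.
    mean_high_entropy_mass (\<alpha> + \<epsilon>) m k n < real k * \<delta>"
proof -
  define e where "e = \<epsilon> * \<delta> / 8"
  have "0 < e" using assms by (simp add: e_def)
  have "\<forall>\<^sub>F m in sequentially. mean_heavy_mass (\<alpha> - e) m < e"
    using mean_heavy_mass_tendsto_0[OF AE] \<open>0 < e\<close> by (intro order_tendstoD(2)) auto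
  moreover have "\<forall>\<^sub>F m in sequentially. cutting_cost \<le> e * real m"
    using \<open>0 < e\<close> by real_asymp
  ultimately show ?thesis using eventually_gt_at_top[of 0]
  proof eventually_elim
    case m_large: (elim m)
    have "\<forall>\<^sub>F k in sequentially. \<forall>i\<ge>k. mean_light_mass (\<alpha> + e) i < e"
      using mean_light_mass_tendsto_0[OF AE] \<open>0 < e\<close>
      by (intro eventually_all_ge_at_top order_tendstoD(2)) auto
    moreover have "\<forall>\<^sub>F k in sequentially. real m * (\<alpha> + e) + log (real b) 6 \<le> e * real k"
      using \<open>0 < e\<close> by real_asymp
    moreover have "\<forall>\<^sub>F k in sequentially. mu.log_cell_count m \<le> real k"
      by real_asymp
    ultimately show ?case using eventually_gt_at_top[of 0]
    proof eventually_elim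
      case k_large: (elim k)
      from eventually_resolves[of "k + m"] show ?case
      proof eventually_elim
        case n_large: (elim n)
        have "\<epsilon> * mean_high_entropy_mass (\<alpha> + \<epsilon>) m k n < 8 * (e * real k)"
          using m_large k_large n_large \<open>0 \<le> \<alpha>\<close> \<open>\<alpha> \<le> 1\<close> \<open>0 < e\<close>
          by (intro mean_high_entropy_mass_less) (auto intro: less_imp_le)
        also have "\<dots> = \<epsilon> * (real k * \<delta>)" by (simp add: e_def)
        finally show ?case using \<open>0 < \<epsilon>\<close> by simp
      qed
    qed
  qed
qed

lemma entropy_porous_proportion_ge:
  assumes "0 < \<epsilon>" "0 < k"
  shows "1 - mean_high_entropy_mass (\<alpha> + \<epsilon>) m k n / (real k * \<epsilon>)
    \<le> real (card {w \<in> words b n. entropy_porous b (\<mu> (word_map b w 0)) \<alpha> \<epsilon> m 1 k}) / real b ^ n"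
proof -
  have "entropy_porous b (\<mu> x) \<alpha> \<epsilon> m 1 k
      \<longleftrightarrow> (\<Sum>i=1..k. mu.high_entropy_mass x (\<alpha> + \<epsilon>) m i) < real k * \<epsilon>" for x
    using mu.entropy_porous_iff[of 1 k] \<open>0 < k\<close> by simp
  then show ?thesis
    unfolding mean_high_entropy_mass_def using assms b_pos
    by (simp only:)
      (intro word_avg_Markov sum_nonneg mu.high_entropy_mass_nonneg mult_pos_pos; simp)
qed

lemma eventually_entropy_porous_typical:
  assumes "AE x in lborel. x \<in> {0..1} \<longrightarrow> exact_dimensional (\<mu> x) \<alpha>"
    and "0 \<le> \<alpha>" "\<alpha> \<le> 1" "0 < \<epsilon>"
  shows "\<forall>\<^sub>F m in sequentially. \<forall>\<^sub>F k in sequentially. \<forall>\<^sub>F n in sequentially.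
    1 - \<epsilon> < real (card {w \<in> words b n. entropy_porous b (\<mu> (word_map b w 0)) \<alpha> \<epsilon> m 1 k})
      / real b ^ n"
proof -
  have "\<forall>\<^sub>F m in sequentially. \<forall>\<^sub>F k in sequentially. \<forall>\<^sub>F n in sequentially.
      mean_high_entropy_mass (\<alpha> + \<epsilon>) m k n < real k * \<epsilon>\<^sup>2"
    using assms by (intro eventually_mean_high_entropy_mass_less) auto
  then show ?thesis
  proof eventually_elim
    case (elim m)
    with eventually_gt_at_top[of 0] show ?case
    proof eventually_elim
      case k_large: (elim k)
      from k_large(2) show ?case
      proof eventually_elim
        case (elim n)
        then have "mean_high_entropy_mass (\<alpha> + \<epsilon>) m k n / (real k * \<epsilon>) < \<epsilon>"
          using k_large(1) \<open>0 < \<epsilon>\<close> by (simp add: power2_eq_square field_simps)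
        then show ?case
          using entropy_porous_proportion_ge[OF \<open>0 < \<epsilon>\<close> k_large(1), of \<alpha> m n] by linarith
      qed
    qed
  qed
qed

end

lemma periodic_add_of_int:
  fixes f :: "real \<Rightarrow> 'a"
  assumes "\<And>x. f (x + 1) = f x"
  shows "f (x + of_int k) = f x"
proof (induction k rule: int_induct[where k=0])
  case (step1 i)
  then show ?case using assms[of "x + of_int i"] by (simp add: add.assoc)
next
  case (step2 i)
  then show ?case using assms[of "x + of_int (i - 1)"] by (simp add: add.assoc)
qed simp

lemma abs_periodic_lipschitz_le:
  fixes f :: "real \<Rightarrow> real"
  assumes "\<And>x. f (x + 1) = f x" "L-lipschitz_on UNIV f"
  shows "\<bar>f x\<bar> \<le> \<bar>f 0\<bar> + L"
proof -
  have "f x = f (frac x)"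
    using periodic_add_of_int[of f "frac x" "\<lfloor>x\<rfloor>"] assms(1) by (simp add: frac_def)
  moreover have "\<bar>f (frac x) - f 0\<bar> \<le> L * \<bar>frac x - 0\<bar>"
    using lipschitz_onD[OF assms(2), of "frac x" 0] by (simp add: dist_real_def)
  moreover have "L * \<bar>frac x - 0\<bar> \<le> L * 1"
    using frac_lt_1[of x] by (intro mult_left_mono lipschitz_on_nonneg[OF assms(2)]) auto
  ultimately show ?thesis by linarith
qed

theorem theorem5p2:
  fixes b :: nat and \<gamma> :: real and \<phi> :: "real \<Rightarrow> real" and \<alpha> :: real
  assumes "b \<ge> 2"
    and "0 < \<gamma>" and "\<gamma> < 1"
    and "\<forall>x. \<phi> (x + 1) = \<phi> x"
    and "\<exists>L. L-lipschitz_on UNIV \<phi>"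
    and "condH b \<gamma> \<phi>"
    and "0 \<le> \<alpha>" and "\<alpha> \<le> 1"
    and "AE x in lborel. x \<in> {0..1} \<longrightarrow> exact_dimensional (mx b \<gamma> \<phi> x) \<alpha>"
  shows "\<forall>\<epsilon>>0. \<exists>M1. \<forall>m\<ge>M1. \<exists>K1. \<forall>k\<ge>K1. \<exists>N1. \<forall>n\<ge>N1.
           real (card {w \<in> words b n.
                   entropy_porous b (mx b \<gamma> \<phi> (word_map b w 0)) \<alpha> \<epsilon> m 1 k}) / real b ^ n
           > 1 - \<epsilon>"
proof -
  obtain L where Lipschitz: "L-lipschitz_on UNIV \<phi>" using assms(5) by blast
  interpret weierstrass b \<gamma> \<phi> L "\<bar>\<phi> 0\<bar> + L"
    using assms(1-4) Lipschitz by unfold_locales (auto intro: abs_periodic_lipschitz_le)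
  show ?thesis
    using eventually_entropy_porous_typical[OF assms(9,7,8)]
    unfolding eventually_sequentially by blast
qed

end
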